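(* If $\Omega$ is a quasi-conical open set of $\mathbb R^3$ and $\mathcal M$ is the Maxwell operator in $\Omega$, then $\sigma_e(\mathcal M)=[0,+\infty)$.
   Context: An open set $\Omega\subset\mathbb R^3$ is quasi-conical if there exists a sequence of pairwise disjoint cubes $Q_n(d_n)\subset\Omega$ of edge length $d_n$ with $d_n\to+\infty$. No regularity of $\partial\Omega$ is required. Notation for an open set $\Omega\subseteq\mathbb R^3$: $\|\cdot\|$ is the $L^2$-norm. $\dot H^1_0(\Omega)=\{\varphi\in L^6(\Omega):\nabla\varphi\in L^2(\Omega)^3,\ \varphi=0\text{ locally on }\partial\Omega\}$. $H(\operatorname{div}0,\Omega)=\{u\in L^2(\Omega)^3:(u,\nabla\xi)=0\ \forall \xi\in\dot H^1_0(\Omega)\}$ (divergence-free fields). $H(\operatorname{curl},\Omega)=\{u\in L^2(\Omega)^3:\operatorname{curl}u\in L^2(\Omega)^3\}$ with graph norm; $H_0(\operatorname{curl},\Omega)$ is the closure of $C_c^\infty(\Omega)^3$ in it. $X_{N0}(\Omega)=H_0(\operatorname{curl},\Omega)\cap H(\operatorname{div}0,\Omega)$. The Maxwell operator $\mathcal M$ (formally $\operatorname{curl}\operatorname{curl}$) is the unique nonnegative self-adjoint operator in the Hilbert space $(H(\operatorname{div}0,\Omega),\|\cdot\|)$ associated with the closed densely defined quadratic form $u\mapsto\int_\Omega|\operatorname{curl}u|^2dx$, with form domain $X_{N0}(\Omega)$. Its essential spectrum is $$\sigma_e(\mathcal M)=\{\lambda\in\mathbb C:\exists (x_n)_n\subset\operatorname{dom}(\mathcal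 M),\ \|x_n\|=1,\ x_n\rightharpoonup0,\ \|(\mathcal M-\lambda)x_n\|\to0\}.$$ *)

theory Defs
  imports "HOL-Analysis.Analysis"
begin

text \<open>
  Functions on an open set \<open>\<Omega>\<close> are represented by total functions on \<open>real^3\<close>; only their values
  on \<open>\<Omega>\<close> matter, through the measure \<open>lebesgue_on \<Omega>\<close>. Elements of the \<open>L\<^sup>p\<close> spaces are
  representatives, not equivalence classes: every set of functions below is invariant
  under almost everywhere equality on \<open>\<Omega>\<close>, apart from the sets of test functions. All function
  spaces are complex.
\<close>

type_synonym scalar_field = "real^3 \<Rightarrow> complex"
type_synonym vector_field = "real^3 \<Rightarrow> complex^3"

definition open_cube :: "real \<Rightarrow> (real^3) set \<Rightarrow> bool" where
  "open_cube d Q \<longleftrightarrow> 0 < d \<and>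
     (\<exists>(a :: real^3) (R :: real^3 \<Rightarrow> real^3). orthogonal_transformation R \<and> Q = (\<lambda>x. a + R x) ` box 0 (\<chi> i. d))"

definition quasi_conical :: "(real^3) set \<Rightarrow> bool" where
  "quasi_conical \<Omega> \<longleftrightarrow>
     (\<exists>(Q :: nat \<Rightarrow> (real^3) set) (d :: nat \<Rightarrow> real).
        (\<forall>n. open_cube (d n) (Q n) \<and> Q n \<subseteq> \<Omega>) \<and>
        disjoint_family Q \<and> filterlim d at_top sequentially)"

definition partial_deriv :: "3 \<Rightarrow> (real^3 \<Rightarrow> 'b::real_normed_vector) \<Rightarrow> real^3 \<Rightarrow> 'b" where
  "partial_deriv i f x = frechet_derivative f (at x) (axis i 1)"

primrec C_k :: "nat \<Rightarrow> (real^3 \<Rightarrow> 'b::real_normed_vector) \<Rightarrow> bool" where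
  "C_k 0 f \<longleftrightarrow> continuous_on UNIV f"
| "C_k (Suc k) f \<longleftrightarrow> (\<forall>x. f differentiable (at x)) \<and> (\<forall>i. C_k k (partial_deriv i f))"

definition test_functions :: "(real^3) set \<Rightarrow> (real^3 \<Rightarrow> 'b::real_normed_vector) set" where
  "test_functions \<Omega> =
     {f. (\<forall>k. C_k k f) \<and> compact (closure {x. f x \<noteq> 0}) \<and> closure {x. f x \<noteq> 0} \<subseteq> \<Omega>}"

definition Lp :: "nat \<Rightarrow> (real^3) set \<Rightarrow> (real^3 \<Rightarrow> 'b::euclidean_space) set" where
  "Lp p \<Omega> = {f \<in> borel_measurable (lebesgue_on \<Omega>).
               integrable (lebesgue_on \<Omega>) (\<lambda>x. norm (f x) ^ p)}"

definition L2_norm :: "(real^3) set \<Rightarrow> (real^3 \<Rightarrow> 'b::euclidean_space) \<Rightarrow> real" where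
  "L2_norm \<Omega> f = sqrt (integral\<^sup>L (lebesgue_on \<Omega>) (\<lambda>x. (norm (f x))\<^sup>2))"

definition L2_inner :: "(real^3) set \<Rightarrow> vector_field \<Rightarrow> vector_field \<Rightarrow> complex" where
  "L2_inner \<Omega> u v = integral\<^sup>L (lebesgue_on \<Omega>) (\<lambda>x. \<Sum>i\<in>UNIV. u x $ i * cnj (v x $ i))"

text \<open>
  The two predicates below are meaningful for locally integrable functions only (otherwise the
  Bochner integrals may default to 0); they are always used together with membership in
  some \<open>Lp p \<Omega>\<close> with \<open>p \<ge> 1\<close>. Weak derivatives are unique up to null sets, which justifies
  the choice operators.
\<close>

definition has_weak_grad :: "(real^3) set \<Rightarrow> scalar_field \<Rightarrow> vector_field \<Rightarrow> bool" where
  "has_weak_grad \<Omega> \<phi> g \<longleftrightarrow>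
     (\<forall>\<psi> \<in> test_functions \<Omega>. \<forall>i.
        integral\<^sup>L (lebesgue_on \<Omega>) (\<lambda>x. \<phi> x * partial_deriv i \<psi> x) =
        - integral\<^sup>L (lebesgue_on \<Omega>) (\<lambda>x. g x $ i * \<psi> x))"

definition weak_grad :: "(real^3) set \<Rightarrow> scalar_field \<Rightarrow> vector_field" where
  "weak_grad \<Omega> \<phi> = (SOME g. g \<in> Lp 2 \<Omega> \<and> has_weak_grad \<Omega> \<phi> g)"

definition classical_curl :: "vector_field \<Rightarrow> vector_field" where
  "classical_curl \<psi> x = vector
     [partial_deriv 2 \<psi> x $ 3 - partial_deriv 3 \<psi> x $ 2,
      partial_deriv 3 \<psi> x $ 1 - partial_deriv 1 \<psi> x $ 3,
      partial_deriv 1 \<psi> x $ 2 - partial_deriv 2 \<psi> x $ 1]"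

definition has_weak_curl :: "(real^3) set \<Rightarrow> vector_field \<Rightarrow> vector_field \<Rightarrow> bool" where
  "has_weak_curl \<Omega> u w \<longleftrightarrow>
     (\<forall>\<psi> \<in> test_functions \<Omega>. L2_inner \<Omega> u (classical_curl \<psi>) = L2_inner \<Omega> w \<psi>)"

definition weak_curl :: "(real^3) set \<Rightarrow> vector_field \<Rightarrow> vector_field" where
  "weak_curl \<Omega> u = (SOME w. w \<in> Lp 2 \<Omega> \<and> has_weak_curl \<Omega> u w)"

definition H1 :: "(real^3) set \<Rightarrow> scalar_field set" where
  "H1 \<Omega> = {\<phi> \<in> Lp 2 \<Omega>. \<exists>g \<in> Lp 2 \<Omega>. has_weak_grad \<Omega> \<phi> g}"

definition H1_norm :: "(real^3) set \<Rightarrow> scalar_field \<Rightarrow> real" where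
  "H1_norm \<Omega> \<phi> = sqrt ((L2_norm \<Omega> \<phi>)\<^sup>2 + (L2_norm \<Omega> (weak_grad \<Omega> \<phi>))\<^sup>2)"

definition H1_0 :: "(real^3) set \<Rightarrow> scalar_field set" where
  "H1_0 \<Omega> = {\<phi> \<in> H1 \<Omega>. \<forall>e>0. \<exists>\<psi> \<in> test_functions \<Omega>. H1_norm \<Omega> (\<lambda>x. \<psi> x - \<phi> x) < e}"

text \<open>
  ``\<open>\<phi> = 0\<close> locally on the boundary'' is understood in the sense of the usual Dirichlet space:
  \<open>\<phi>\<close> times any smooth compactly supported cut-off function on \<open>\<real>\<^sup>3\<close> belongs to \<open>H1_0 \<Omega>\<close>.
\<close>

definition dot_H1_0 :: "(real^3) set \<Rightarrow> scalar_field set" where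
  "dot_H1_0 \<Omega> = {\<phi> \<in> Lp 6 \<Omega>. (\<exists>g \<in> Lp 2 \<Omega>. has_weak_grad \<Omega> \<phi> g) \<and>
     (\<forall>\<eta> \<in> test_functions UNIV. (\<lambda>x. \<eta> x * \<phi> x) \<in> H1_0 \<Omega>)}"

definition H_div0 :: "(real^3) set \<Rightarrow> vector_field set" where
  "H_div0 \<Omega> = {u \<in> Lp 2 \<Omega>. \<forall>\<xi> \<in> dot_H1_0 \<Omega>. L2_inner \<Omega> u (weak_grad \<Omega> \<xi>) = 0}"

definition H_curl :: "(real^3) set \<Rightarrow> vector_field set" where
  "H_curl \<Omega> = {u \<in> Lp 2 \<Omega>. \<exists>w \<in> Lp 2 \<Omega>. has_weak_curl \<Omega> u w}"

definition H_curl_norm :: "(real^3) set \<Rightarrow> vector_field \<Rightarrow> real" where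
  "H_curl_norm \<Omega> u = sqrt ((L2_norm \<Omega> u)\<^sup>2 + (L2_norm \<Omega> (weak_curl \<Omega> u))\<^sup>2)"

definition H0_curl :: "(real^3) set \<Rightarrow> vector_field set" where
  "H0_curl \<Omega> =
     {u \<in> H_curl \<Omega>. \<forall>e>0. \<exists>\<psi> \<in> test_functions \<Omega>. H_curl_norm \<Omega> (\<lambda>x. \<psi> x - u x) < e}"

definition X_N0 :: "(real^3) set \<Rightarrow> vector_field set" where
  "X_N0 \<Omega> = H0_curl \<Omega> \<inter> H_div0 \<Omega>"

text \<open>
  The operator associated with a form \<open>a\<close> with domain \<open>V\<close> in the closed subspace \<open>H\<close> of
  \<open>L\<^sup>2(\<Omega>)\<^sup>3\<close>, in the sense of Kato's first representation theorem, given by its graph.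
\<close>

definition form_operator ::
  "(real^3) set \<Rightarrow> vector_field set \<Rightarrow> vector_field set \<Rightarrow>
     (vector_field \<Rightarrow> vector_field \<Rightarrow> complex) \<Rightarrow> (vector_field \<times> vector_field) set" where
  "form_operator \<Omega> H V a = {(u, f). u \<in> V \<and> f \<in> H \<and> (\<forall>v \<in> V. a u v = L2_inner \<Omega> f v)}"

definition maxwell_operator :: "(real^3) set \<Rightarrow> (vector_field \<times> vector_field) set" where
  "maxwell_operator \<Omega> = form_operator \<Omega> (H_div0 \<Omega>) (X_N0 \<Omega>)
     (\<lambda>u v. L2_inner \<Omega> (weak_curl \<Omega> u) (weak_curl \<Omega> v))"

definition essential_spectrum ::
  "(real^3) set \<Rightarrow> vector_field set \<Rightarrow> (vector_field \<times> vector_field) set \<Rightarrow> complex set" where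
  "essential_spectrum \<Omega> H T =
     {z. \<exists>(x :: nat \<Rightarrow> vector_field) (f :: nat \<Rightarrow> vector_field).
        (\<forall>n. (x n, f n) \<in> T \<and> L2_norm \<Omega> (x n) = 1) \<and>
        (\<forall>v \<in> H. (\<lambda>n. L2_inner \<Omega> (x n) v) \<longlonglongrightarrow> 0) \<and>
        (\<lambda>n. L2_norm \<Omega> (\<lambda>y. f n y - z *s x n y)) \<longlonglongrightarrow> 0}"

end

theory Submission
  imports Defs
begin

text \<open>
  The inclusion of \<open>\<sigma>\<^sub>e(\<M>)\<close> in \<open>[0, \<infinity>)\<close> is the nonnegativity of the form. Testing the equation of a singular
  sequence with \<open>x\<^sub>n\<close> itself gives \<open>(f\<^sub>n - z x\<^sub>n, x\<^sub>n) = \<parallel>curl x\<^sub>n\<parallel>\<^sup>2 - z\<close>, and the left-hand side tends to 0,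
  so \<open>z\<close> is a limit of nonnegative reals (\<open>essential_spectrum_maxwell_nonneg\<close>).

  Conversely, let \<open>\<lambda> \<ge> 0\<close>. In a cube of half edge \<open>r\<close> one places a plane wave cut off at scale \<open>r\<close>: for a
  scalar \<open>p(x) = e\<^sup>i\<^sup>w\<^sup>x\<^sub>1 b((x\<^sub>1 - c\<^sub>1)/r) b((x\<^sub>2 - c\<^sub>2)/r) b((x\<^sub>3 - c\<^sub>3)/r)\<close>, with \<open>b\<close> a smooth bump supported in
  \<open>[-1, 1]\<close>, the field \<open>u = curl (0, 0, p) = (\<partial>\<^sub>2p, -\<partial>\<^sub>1p, 0)\<close> is divergence-free, smooth and compactly
  supported in the cube. Hence it lies in the operator domain whatever the boundary of \<open>\<Omega>\<close> looks like,
  and \<open>\<M>u = curl curl u\<close> is the same expression formed from \<open>-\<Delta>p\<close>. With \<open>w = sqrt \<lambda> + 1/r\<close> every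
  derivative that falls on the cut-off costs a factor \<open>1/r\<close>, while \<open>\<parallel>u\<parallel>\<close> is at least of order
  \<open>w r\<^sup>3\<^sup>/\<^sup>2\<close>, so that \<open>\<parallel>\<M>u - \<lambda>u\<parallel> \<le> C (w / r) \<parallel>u\<parallel>\<close> with \<open>C\<close> independent of \<open>r\<close> (\<open>maxwell_quasimode\<close>).
  The shift of the frequency by \<open>1/r\<close> is what lets the argument include \<open>\<lambda> = 0\<close>: there it keeps the
  wave length comparable to the cube, and without it the lower bound for \<open>\<parallel>u\<parallel>\<close> would be void. A quasi-conical \<open>\<Omega>\<close> contains
  disjoint cubes with \<open>r \<rightarrow> \<infinity>\<close>; disjointness of the supports makes the normalised fields converge
  weakly to 0, so they form a singular sequence for \<open>\<lambda>\<close>.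

  Two facts about weak derivatives stand behind the claim that \<open>u\<close> lies in the domain. Integration
  by parts (\<open>integration_by_parts\<close>) shows that the classical curl is a weak curl, and the fundamental
  lemma of the calculus of variations (\<open>fundamental_lemma_calculus_of_variations\<close>) shows that the weak
  curl is unique, so that it agrees with the classical one almost everywhere.

  All scalar functions that occur are products of functions of one coordinate. Each factor comes
  with the sequence of all its derivatives (\<open>derivative_chain\<close>), so partial derivatives of a product
  only shift indices; in particular they commute by inspection.
\<close>

section \<open>Calculus of test functions\<close>

lemma partial_deriv_eqI:
  "(f has_derivative D) (at x) \<Longrightarrow> partial_deriv i f x = D (axis i 1)"
  unfolding partial_deriv_def by (metis frechet_derivative_at)

lemma partial_deriv_linear:
  assumes "bounded_linear L" "f differentiable (at x)"
  shows "partial_deriv i (\<lambda>x. L (f x)) x = L (partial_deriv i f x)"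
proof -
  have "(f has_derivative frechet_derivative f (at x)) (at x)"
    using assms(2) frechet_derivative_works by blast
  from bounded_linear.has_derivative[OF assms(1) this]
  show ?thesis unfolding partial_deriv_def by (metis frechet_derivative_at)
qed

lemma partial_deriv_add:
  assumes "f differentiable (at x)" "g differentiable (at x)"
  shows "partial_deriv i (\<lambda>x. f x + g x) x = partial_deriv i f x + partial_deriv i g x"
  using partial_deriv_eqI[OF has_derivative_add[OF assms[unfolded frechet_derivative_works]]]
  by (simp add: partial_deriv_def)

lemma differentiable_linear:
  "bounded_linear L \<Longrightarrow> f differentiable F \<Longrightarrow> (\<lambda>x. L (f x)) differentiable F"
  unfolding differentiable_def using bounded_linear.has_derivative by blast

lemma C_k_linear:
  assumes L: "bounded_linear L"
  shows "C_k k f \<Longrightarrow> C_k k (\<lambda>x. L (f x))"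
proof (induction k arbitrary: f)
  case 0
  then show ?case using bounded_linear.continuous_on[OF L] by auto
next
  case (Suc k)
  then have "partial_deriv i (\<lambda>x. L (f x)) = (\<lambda>x. L (partial_deriv i f x))" for i
    by (intro ext partial_deriv_linear[OF L]) auto
  with Suc show ?case by (auto intro: differentiable_linear[OF L])
qed

lemma C_k_add: "C_k k f \<Longrightarrow> C_k k g \<Longrightarrow> C_k k (\<lambda>x. f x + g x)"
proof (induction k arbitrary: f g)
  case 0
  then show ?case by (auto intro: continuous_on_add)
next
  case (Suc k)
  then have "partial_deriv i (\<lambda>x. f x + g x) = (\<lambda>x. partial_deriv i f x + partial_deriv i g x)" for i
    by (intro ext partial_deriv_add) auto
  with Suc show ?case by (auto intro: differentiable_add)
qed

lemma C_k_zero: "C_k k (\<lambda>x. 0 :: 'a::real_normed_vector)"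
proof -
  have "partial_deriv i (\<lambda>x. 0 :: 'a) = (\<lambda>x. 0)" for i
    by (intro ext partial_deriv_eqI[where D="\<lambda>_. 0"] has_derivative_const)
  then show ?thesis by (induction k) auto
qed

lemma bounded_linear_axis: "bounded_linear (axis i :: 'a::euclidean_space \<Rightarrow> 'a^'n)"
  by (rule linear_conv_bounded_linear[THEN iffD1], standard) (auto simp: axis_def vec_eq_iff)

lemma test_functionsI:
  assumes "\<And>k. C_k k f" "compact K" "K \<subseteq> \<Omega>" "\<And>x. x \<notin> K \<Longrightarrow> f x = 0"
  shows "f \<in> test_functions \<Omega>"
proof -
  have "closure {x. f x \<noteq> 0} \<subseteq> K"
    using assms by (intro closure_minimal) (auto simp: compact_imp_closed)
  moreover from this have "compact (closure {x. f x \<noteq> 0})"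
    using bounded_subset[OF compact_imp_bounded[OF assms(2)]] by (auto simp: compact_eq_bounded_closed)
  ultimately show ?thesis using assms unfolding test_functions_def by blast
qed

lemma test_functionsE:
  assumes "f \<in> test_functions \<Omega>"
  obtains K where "compact K" "K \<subseteq> \<Omega>" "\<And>x. x \<notin> K \<Longrightarrow> f x = 0"
  using assms that[of "closure {x. f x \<noteq> 0}"] closure_subset[of "{x. f x \<noteq> 0}"]
  unfolding test_functions_def by blast

lemma test_functions_C_k: "f \<in> test_functions \<Omega> \<Longrightarrow> C_k k f"
  by (auto simp: test_functions_def)

lemma test_functions_zero_outside: "f \<in> test_functions \<Omega> \<Longrightarrow> x \<notin> \<Omega> \<Longrightarrow> f x = 0"
  by (elim test_functionsE) auto

lemma test_functions_differentiable: "f \<in> test_functions \<Omega> \<Longrightarrow> f differentiable (at x)"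
  using test_functions_C_k[of f \<Omega> "Suc 0"] by auto

lemma test_functions_continuous: "f \<in> test_functions \<Omega> \<Longrightarrow> continuous_on UNIV f"
  using test_functions_C_k[of f \<Omega> 0] by auto

lemma test_functions_linear:
  assumes L: "bounded_linear L" and f: "f \<in> test_functions \<Omega>"
  shows "(\<lambda>x. L (f x)) \<in> test_functions \<Omega>"
proof -
  obtain K where "compact K" "K \<subseteq> \<Omega>" "\<And>x. x \<notin> K \<Longrightarrow> f x = 0"
    using test_functionsE[OF f] by blast
  moreover have "C_k k (\<lambda>x. L (f x))" for k
    using C_k_linear[OF L] test_functions_C_k[OF f] by blast
  ultimately show ?thesis
    using linear_0[OF bounded_linear.linear[OF L]] by (intro test_functionsI[of _ K]) auto
qed

lemma test_functions_add:
  assumes f: "f \<in> test_functions \<Omega>" and g: "g \<in> test_functions \<Omega>"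
  shows "(\<lambda>x. f x + g x) \<in> test_functions \<Omega>"
proof -
  obtain K where K: "compact K" "K \<subseteq> \<Omega>" "\<And>x. x \<notin> K \<Longrightarrow> f x = 0"
    using test_functionsE[OF f] by blast
  obtain K' where K': "compact K'" "K' \<subseteq> \<Omega>" "\<And>x. x \<notin> K' \<Longrightarrow> g x = 0"
    using test_functionsE[OF g] by blast
  have "C_k k (\<lambda>x. f x + g x)" for k
    using C_k_add test_functions_C_k f g by blast
  then show ?thesis using K K'
    by (intro test_functionsI[of _ "K \<union> K'"]) auto
qed

lemma test_functions_diff:
  assumes f: "f \<in> test_functions \<Omega>" and g: "g \<in> test_functions \<Omega>"
  shows "(\<lambda>x. f x - g x) \<in> test_functions \<Omega>"
  using test_functions_add[OF f test_functions_linear[OF bounded_linear_minus[OF bounded_linear_ident] g]]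
  by simp

lemma partial_deriv_zero_off_closed:
  assumes "closed K" "\<And>x. x \<notin> K \<Longrightarrow> f x = 0" "x \<notin> K"
  shows "partial_deriv i f x = 0"
proof (rule partial_deriv_eqI[where D="\<lambda>_. 0"])
  show "(f has_derivative (\<lambda>_. 0)) (at x)"
    by (rule has_derivative_transform_within_open[of "\<lambda>_. 0" _ _ _ "- K"]) (use assms in auto)
qed

lemma test_functions_partial_deriv:
  assumes f: "f \<in> test_functions \<Omega>"
  shows "partial_deriv i f \<in> test_functions \<Omega>"
proof -
  obtain K where "compact K" "K \<subseteq> \<Omega>" "\<And>x. x \<notin> K \<Longrightarrow> f x = 0"
    using test_functionsE[OF f] by blast
  moreover have "C_k k (partial_deriv i f)" for k
    using test_functions_C_k[OF f, of "Suc k"] by auto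
  ultimately show ?thesis
    using partial_deriv_zero_off_closed[of K f]
    by (intro test_functionsI[of _ K]) (auto simp: compact_imp_closed)
qed

lemma test_functions_component:
  fixes f :: "real^3 \<Rightarrow> 'a::euclidean_space^3"
  shows "f \<in> test_functions \<Omega> \<Longrightarrow> (\<lambda>x. f x $ i) \<in> test_functions \<Omega>"
  by (rule test_functions_linear[OF bounded_linear_vec_nth])

lemma partial_deriv_component:
  fixes f :: "real^3 \<Rightarrow> 'a::euclidean_space^3"
  assumes "f \<in> test_functions \<Omega>"
  shows "partial_deriv j f x $ i = partial_deriv j (\<lambda>x. f x $ i) x"
  using partial_deriv_linear[OF bounded_linear_vec_nth test_functions_differentiable[OF assms]] by metis

lemma test_functions_componentwise:
  fixes f :: "real^3 \<Rightarrow> 'a::euclidean_space^3"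
  assumes "\<And>i. (\<lambda>x. f x $ i) \<in> test_functions \<Omega>"
  shows "f \<in> test_functions \<Omega>"
proof -
  have "(\<lambda>x. axis 1 (f x $ 1) + axis 2 (f x $ 2) + axis 3 (f x $ 3) :: 'a^3) \<in> test_functions \<Omega>"
    by (intro test_functions_add test_functions_linear[OF bounded_linear_axis assms])
  also have "(\<lambda>x. axis 1 (f x $ 1) + axis 2 (f x $ 2) + axis 3 (f x $ 3)) = f"
    by (auto simp: vec_eq_iff forall_3 axis_def fun_eq_iff)
  finally show ?thesis .
qed

lemma classical_curl_component:
  "classical_curl \<psi> x $ 1 = partial_deriv 2 \<psi> x $ 3 - partial_deriv 3 \<psi> x $ 2"
  "classical_curl \<psi> x $ 2 = partial_deriv 3 \<psi> x $ 1 - partial_deriv 1 \<psi> x $ 3"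
  "classical_curl \<psi> x $ 3 = partial_deriv 1 \<psi> x $ 2 - partial_deriv 2 \<psi> x $ 1"
  by (auto simp: classical_curl_def)

lemma test_functions_classical_curl:
  assumes "\<psi> \<in> test_functions \<Omega>"
  shows "classical_curl \<psi> \<in> test_functions \<Omega>"
proof (rule test_functions_componentwise)
  have *: "(\<lambda>x. partial_deriv i \<psi> x $ j - partial_deriv k \<psi> x $ l) \<in> test_functions \<Omega>" for i j k l
    by (intro test_functions_diff test_functions_component test_functions_partial_deriv assms)
  have "\<forall>i. (\<lambda>x. classical_curl \<psi> x $ i) \<in> test_functions \<Omega>"
    unfolding forall_3 classical_curl_component by (intro conjI *)
  then show "(\<lambda>x. classical_curl \<psi> x $ i) \<in> test_functions \<Omega>" for i by blast
qed

section \<open>Products of functions of one coordinate\<close>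

text \<open>
  A smooth function is carried along with its derivatives of every order, \<open>F n\<close> being the
  \<open>n\<close>-th derivative of \<open>F 0\<close>.
\<close>
definition derivative_chain :: "(nat \<Rightarrow> real \<Rightarrow> complex) \<Rightarrow> bool" where
  "derivative_chain F \<longleftrightarrow> (\<forall>n t. (F n has_vector_derivative F (Suc n) t) (at t))"

definition tensor :: "(real \<Rightarrow> complex) \<Rightarrow> (real \<Rightarrow> complex) \<Rightarrow> (real \<Rightarrow> complex) \<Rightarrow> scalar_field" where
  "tensor f g h x = f (x $ 1) * g (x $ 2) * h (x $ 3)"

lemma tensor_has_derivative:
  assumes "\<And>t. (f has_vector_derivative f' t) (at t)" "\<And>t. (g has_vector_derivative g' t) (at t)"
    "\<And>t. (h has_vector_derivative h' t) (at t)"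
  shows "(tensor f g h has_derivative (\<lambda>v. complex_of_real (v $ 1) * tensor f' g h x
    + complex_of_real (v $ 2) * tensor f g' h x + complex_of_real (v $ 3) * tensor f g h' x)) (at x)"
proof -
  have *: "((\<lambda>x. f (x $ i)) has_derivative (\<lambda>v. complex_of_real (v $ i) * f' (x $ i))) (at x)"
    if "\<And>t. (f has_vector_derivative f' t) (at t)" for f f' and i :: 3
  proof -
    have "((\<lambda>x::real^3. x $ i) has_derivative (\<lambda>v. v $ i)) (at x)"
      by (rule bounded_linear.has_derivative[OF bounded_linear_vec_nth has_derivative_ident])
    from has_derivative_compose[OF this, of f "\<lambda>v. v *\<^sub>R f' (x $ i)"] that
    show ?thesis by (simp add: has_vector_derivative_def scaleR_conv_of_real)
  qed
  show ?thesis unfolding tensor_def[abs_def]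
    by (rule has_derivative_eq_rhs[OF has_derivative_mult[OF has_derivative_mult[OF
      *[OF assms(1)] *[OF assms(2)]] *[OF assms(3)]]])
      (auto simp: fun_eq_iff algebra_simps)
qed

lemma
  assumes "derivative_chain F" "derivative_chain G" "derivative_chain H"
  shows tensor_differentiable: "tensor (F a) (G b) (H c) differentiable (at x)"
    and partial_deriv_tensor:
      "partial_deriv 1 (tensor (F a) (G b) (H c)) = tensor (F (Suc a)) (G b) (H c)"
      "partial_deriv 2 (tensor (F a) (G b) (H c)) = tensor (F a) (G (Suc b)) (H c)"
      "partial_deriv 3 (tensor (F a) (G b) (H c)) = tensor (F a) (G b) (H (Suc c))"
proof -
  note * = tensor_has_derivative[of "F a" "F (Suc a)" "G b" "G (Suc b)" "H c" "H (Suc c)"]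
  note ** = *[OF assms[unfolded derivative_chain_def, rule_format]]
  show "tensor (F a) (G b) (H c) differentiable (at x)"
    using ** differentiable_def by blast
  show "partial_deriv 1 (tensor (F a) (G b) (H c)) = tensor (F (Suc a)) (G b) (H c)"
      "partial_deriv 2 (tensor (F a) (G b) (H c)) = tensor (F a) (G (Suc b)) (H c)"
      "partial_deriv 3 (tensor (F a) (G b) (H c)) = tensor (F a) (G b) (H (Suc c))"
    by (auto simp: fun_eq_iff partial_deriv_eqI[OF **] axis_def)
qed

text \<open>
  The family of all products \<open>F a \<otimes> G b \<otimes> H c\<close> is closed under partial derivatives, which is why the
  induction runs over all \<open>a\<close>, \<open>b\<close>, \<open>c\<close> at once.
\<close>
lemma C_k_tensor:
  assumes "derivative_chain F" "derivative_chain G" "derivative_chain H"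
  shows "C_k k (tensor (F a) (G b) (H c))"
proof (induction k arbitrary: a b c)
  case 0
  then show ?case 
    using tensor_differentiable[OF assms, of a b c] differentiable_imp_continuous_within
    by (auto intro!: continuous_at_imp_continuous_on)
next
  case (Suc k)
  then show ?case
    using tensor_differentiable[OF assms, of a b c]
    by (auto simp: forall_3 partial_deriv_tensor[OF assms])
qed

lemma test_functions_tensor:
  assumes "derivative_chain F" "derivative_chain G" "derivative_chain H"
    and "cbox l u \<subseteq> \<Omega>"
    and "\<And>t. t \<notin> {l $ 1..u $ 1} \<Longrightarrow> F a t = 0" "\<And>t. t \<notin> {l $ 2..u $ 2} \<Longrightarrow> G b t = 0"
      "\<And>t. t \<notin> {l $ 3..u $ 3} \<Longrightarrow> H c t = 0"
  shows "tensor (F a) (G b) (H c) \<in> test_functions \<Omega>"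
proof (rule test_functionsI[OF C_k_tensor[OF assms(1-3)] compact_cbox assms(4)])
  fix x assume "x \<notin> cbox l u"
  then consider "x $ 1 \<notin> {l $ 1..u $ 1}" | "x $ 2 \<notin> {l $ 2..u $ 2}" | "x $ 3 \<notin> {l $ 3..u $ 3}"
    unfolding mem_box_cart forall_3 by auto
  then show "tensor (F a) (G b) (H c) x = 0"
    using assms(5-7) by cases (auto simp: tensor_def)
qed

section \<open>Smooth bumps on the line\<close>

text \<open>
  The functions \<open>p(1/t) exp(-1/t)\<close>, extended by 0 to the left half line; the polynomial \<open>p\<close> is there
  so that the derivative stays in the family.
\<close>
definition flat :: "real poly \<Rightarrow> real \<Rightarrow> real" where
  "flat p t = (if 0 < t then poly p (inverse t) * exp (- inverse t) else 0)"

lemma poly_times_exp_uminus_tendsto_0: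
  "((\<lambda>s. poly p s * exp (- s)) \<longlongrightarrow> (0 :: real)) at_top"
proof -
  have "((\<lambda>s. \<Sum>i\<le>degree p. coeff p i * (s ^ i / exp s)) \<longlongrightarrow> (0 :: real)) at_top"
    by (intro tendsto_null_sum tendsto_mult_right_zero tendsto_power_div_exp_0)
  then show ?thesis
    by (simp add: poly_altdef sum_distrib_right exp_minus divide_inverse mult.assoc)
qed

text \<open>
  For \<open>t > 0\<close> this is the chain rule with \<open>s = 1/t\<close> and \<open>ds/dt = -s\<^sup>2\<close>. At the origin the difference
  quotient is \<open>s p(s) exp(-s)\<close> on the right and 0 on the left, and both tend to 0.
\<close>
lemma flat_has_derivative:
  "(flat p has_real_derivative flat ([:0, 0, 1:] * (p - pderiv p)) t) (at t)"
proof (cases t "0 :: real" rule: linorder_cases)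
  case less
  have "((\<lambda>_. 0) has_real_derivative 0) (at t)" by simp
  then have "(flat p has_real_derivative 0) (at t)"
    by (rule has_field_derivative_transform_within_open[of _ _ _ "{..<0}"])
      (use less in \<open>auto simp: flat_def\<close>)
  with less show ?thesis by (simp add: flat_def)
next
  case greater
  have "((\<lambda>t. poly p (inverse t) * exp (- inverse t)) has_real_derivative
      flat ([:0, 0, 1:] * (p - pderiv p)) t) (at t)"
  proof -
    have inv: "(inverse has_real_derivative - (inverse t ^ 2)) (at t)"
      using DERIV_inverse[of t UNIV] greater by (simp add: numeral_2_eq_2)
    have "((\<lambda>t. poly p (inverse t)) has_real_derivative
        poly (pderiv p) (inverse t) * - (inverse t ^ 2)) (at t)"
      by (rule DERIV_chain2[OF poly_DERIV inv])
    moreover have "((\<lambda>t. exp (- inverse t)) has_real_derivative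
        exp (- inverse t) * - (- (inverse t ^ 2))) (at t)"
      by (rule DERIV_chain2[OF DERIV_exp DERIV_minus[OF inv]])
    ultimately have "((\<lambda>t. poly p (inverse t) * exp (- inverse t)) has_real_derivative
        (poly (pderiv p) (inverse t) * - (inverse t ^ 2)) * exp (- inverse t) +
        (exp (- inverse t) * - (- (inverse t ^ 2))) * poly p (inverse t)) (at t)"
      by (rule DERIV_mult)
    moreover have "(poly (pderiv p) (inverse t) * - (inverse t ^ 2)) * exp (- inverse t) +
        (exp (- inverse t) * - (- (inverse t ^ 2))) * poly p (inverse t)
      = flat ([:0, 0, 1:] * (p - pderiv p)) t"
      using greater by (simp add: flat_def power2_eq_square algebra_simps)
    ultimately show ?thesis by simp
  qed
  then show ?thesis
    by (rule has_field_derivative_transform_within_open[of _ _ _ "{0<..}"])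
      (use greater in \<open>auto simp: flat_def\<close>)
next
  case equal
  have right: "((\<lambda>h. flat p h / h) \<longlongrightarrow> 0) (at_right 0)"
  proof -
    have "((\<lambda>h. poly ([:0, 1:] * p) (inverse h) * exp (- inverse h)) \<longlongrightarrow> (0::real)) (at_right 0)"
      by (rule filterlim_compose[OF poly_times_exp_uminus_tendsto_0 filterlim_inverse_at_top_right])
    moreover have "\<forall>\<^sub>F h in at_right 0. flat p h / h = poly ([:0, 1:] * p) (inverse h) * exp (- inverse h)"
      using eventually_at_right_less[of "0::real"]
      by eventually_elim (auto simp: flat_def field_simps)
    ultimately show ?thesis by (simp only: tendsto_cong)
  qed
  have left: "((\<lambda>h. flat p h / h) \<longlongrightarrow> 0) (at_left 0)"
  proof -
    have "\<forall>\<^sub>F h in at_left (0::real). flat p h / h = 0"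
      by (simp add: flat_def eventually_at_filter)
    then show ?thesis by (rule tendsto_eventually)
  qed
  have "((\<lambda>h. flat p h / h) \<longlongrightarrow> 0) (at 0)"
    by (rule filterlim_split_at[OF left right])
  moreover have "flat p 0 = 0" by (simp add: flat_def)
  ultimately have "(flat p has_real_derivative 0) (at 0)"
    unfolding DERIV_def by simp
  with equal show ?thesis by (simp add: flat_def)
qed

text \<open>
  A class of functions that is closed under differentiation for syntactic reasons, and therefore
  consists of smooth functions.
\<close>
inductive elementary :: "(real \<Rightarrow> complex) \<Rightarrow> bool" where
  elementary_const: "elementary (\<lambda>t. c)"
| elementary_flat: "elementary (\<lambda>t. complex_of_real (flat p (s * t + r)))"
| elementary_add: "elementary f \<Longrightarrow> elementary g \<Longrightarrow> elementary (\<lambda>t. f t + g t)"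
| elementary_mult: "elementary f \<Longrightarrow> elementary g \<Longrightarrow> elementary (\<lambda>t. f t * g t)"

lemma elementary_power: "elementary f \<Longrightarrow> elementary (\<lambda>t. f t ^ n)"
  by (induction n) (simp_all add: elementary_const elementary_mult)

lemma elementary_diff: 
  assumes "elementary f" "elementary g"
  shows "elementary (\<lambda>t. f t - g t)"
  using elementary_add[OF assms(1) elementary_mult[OF elementary_const[of "-1"] assms(2)]] by simp

lemma affine_has_vector_derivative:
  fixes f :: "real \<Rightarrow> 'a::real_normed_vector"
  assumes "\<And>t. (f has_vector_derivative f' t) (at t)"
  shows "((\<lambda>t. f (s * t + r)) has_vector_derivative s *\<^sub>R f' (s * t + r)) (at t)"
proof -
  have "((\<lambda>t. s * t + r) has_vector_derivative s) (at t)"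
    by (auto intro!: derivative_eq_intros simp: has_vector_derivative_def)
  from vector_diff_chain_at[OF this assms] show ?thesis by (simp add: o_def)
qed

lemma elementary_derivative:
  "elementary f \<Longrightarrow> \<exists>f'. elementary f' \<and> (\<forall>t. (f has_vector_derivative f' t) (at t))"
proof (induction rule: elementary.induct)
  case (elementary_const c)
  show ?case by (rule exI[of _ "\<lambda>_. 0"]) (simp add: elementary.elementary_const)
next
  case (elementary_flat p s r)
  have "((\<lambda>t. complex_of_real (flat p t)) has_vector_derivative
      of_real (flat ([:0, 0, 1:] * (p - pderiv p)) t)) (at t)" for t
    using flat_has_derivative has_vector_derivative_of_real
      has_real_derivative_iff_has_vector_derivative by blast
  from affine_has_vector_derivative[OF this, of s r]
    elementary_mult[OF elementary.elementary_const[of s] elementary.elementary_flat[of _ s r]]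
  show ?case
    by (intro exI[of _ "\<lambda>t. s * complex_of_real (flat ([:0, 0, 1:] * (p - pderiv p)) (s * t + r))"])
      (simp add: scaleR_conv_of_real)
next
  case (elementary_add f g)
  then obtain f' g' where "elementary f'" "elementary g'"
    "\<And>t. (f has_vector_derivative f' t) (at t)" "\<And>t. (g has_vector_derivative g' t) (at t)" by blast
  then have "elementary (\<lambda>t. f' t + g' t)"
    "((\<lambda>t. f t + g t) has_vector_derivative (f' t + g' t)) (at t)" for t
    by (simp_all add: elementary.elementary_add has_vector_derivative_add)
  then show ?case by blast
next
  case (elementary_mult f g)
  then obtain f' g' where "elementary f'" "elementary g'"
    "\<And>t. (f has_vector_derivative f' t) (at t)" "\<And>t. (g has_vector_derivative g' t) (at t)" by blast
  with elementary_mult(1,2) have "elementary (\<lambda>t. f t * g' t + f' t * g t)"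
    "((\<lambda>t. f t * g t) has_vector_derivative (f t * g' t + f' t * g t)) (at t)" for t
    by (simp_all add: elementary.elementary_add elementary.elementary_mult has_vector_derivative_mult)
  then show ?case by blast
qed

text \<open>
  Iterating a choice of derivative within the class yields derivatives of every order.
\<close>
lemma elementary_derivative_chain:
  assumes "elementary f"
  obtains F where "derivative_chain F" "F 0 = f"
proof -
  define D where "D f = (SOME f'. elementary f' \<and> (\<forall>t. (f has_vector_derivative f' t) (at t)))" for f :: "real \<Rightarrow> complex"
  have D: "elementary (D f) \<and> (\<forall>t. (f has_vector_derivative D f t) (at t))" if "elementary f" for f
    unfolding D_def by (rule someI_ex[OF elementary_derivative[OF that]])
  have "elementary ((D ^^ n) f)" for n
    by (induction n) (simp_all add: D assms)
  then have "derivative_chain (\<lambda>n. (D ^^ n) f)"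
    unfolding derivative_chain_def by (simp add: D)
  then show ?thesis using that[of "\<lambda>n. (D ^^ n) f"] by simp
qed

definition bump :: "real \<Rightarrow> real \<Rightarrow> real \<Rightarrow> real" where
  "bump a b t = flat 1 (t - a) * flat 1 (b - t)"

lemma elementary_bump: "elementary (\<lambda>t. complex_of_real (bump a b t))"
proof -
  have eq: "complex_of_real (bump a b t) =
      complex_of_real (flat 1 (1 * t + (- a))) * complex_of_real (flat 1 ((- 1) * t + b))" for t
    by (simp add: bump_def)
  show ?thesis unfolding eq by (intro elementary_mult elementary_flat)
qed

lemma flat_1_range: "0 \<le> flat 1 t" "flat 1 t \<le> 1"
  by (simp_all add: flat_def)

lemma flat_1_pos_iff: "0 < flat 1 t \<longleftrightarrow> 0 < t"
  by (simp add: flat_def)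

lemma bump_range: "0 \<le> bump a b t" "bump a b t \<le> 1"
  unfolding bump_def using mult_le_one flat_1_range by (blast intro: mult_nonneg_nonneg)+

lemma bump_pos_iff: "0 < bump a b t \<longleftrightarrow> a < t \<and> t < b"
  unfolding bump_def using flat_1_pos_iff[of "t - a"] flat_1_pos_iff[of "b - t"]
    flat_1_range[of "t - a"] flat_1_range[of "b - t"]
  by (simp add: zero_less_mult_iff)

lemma bump_eq_0_iff: "bump a b t = 0 \<longleftrightarrow> \<not> (a < t \<and> t < b)"
  using bump_pos_iff[of a b t] bump_range[of a b t] by force

text \<open>
  If \<open>b\<close> takes values in \<open>[0, 1]\<close> and is positive exactly on the interval, then \<open>1 - (1 - b)\<^sup>j\<close> increases to
  the indicator of the interval, and it is a polynomial in \<open>b\<close>, hence smooth, and it vanishes where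
  \<open>b\<close> does.
\<close>
lemma smooth_interval_indicator:
  obtains F where "\<And>j. derivative_chain (F j)" 
    "\<And>j t. t \<notin> {a<..<b} \<Longrightarrow> F j 0 t = 0"
    "\<And>j t. norm (F j 0 t) \<le> 1"
    "\<And>t. (\<lambda>j. F j 0 t) \<longlonglongrightarrow> indicator {a<..<b} t"
proof -
  have "elementary (\<lambda>t. 1 - (1 - complex_of_real (bump a b t)) ^ j)" for j
    by (intro elementary_diff elementary_const elementary_power elementary_bump)
  then have "\<exists>F. derivative_chain F \<and> F 0 = (\<lambda>t. 1 - (1 - complex_of_real (bump a b t)) ^ j)" for j
    by (metis elementary_derivative_chain)
  then obtain F where F: "\<And>j. derivative_chain (F j)" 
    "\<And>j. F j 0 = (\<lambda>t. 1 - (1 - complex_of_real (bump a b t)) ^ j)" by metis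
  have eq: "F j 0 t = complex_of_real (1 - (1 - bump a b t) ^ j)" for j t
    by (simp add: F)
  have 1: "0 \<le> (1 - bump a b t) ^ j" "(1 - bump a b t) ^ j \<le> 1" for j t
    using bump_range[of a b t] by (auto intro!: power_le_one)
  show ?thesis
  proof (rule that[OF F(1)])
    show "F j 0 t = 0" if "t \<notin> {a<..<b}" for j t
      using that bump_eq_0_iff[of a b t] by (auto simp: eq)
    show "norm (F j 0 t) \<le> 1" for j t
      unfolding eq norm_of_real using 1[where j=j and t=t] by linarith
    show "(\<lambda>j. F j 0 t) \<longlonglongrightarrow> indicator {a<..<b} t" for t
    proof (cases "t \<in> {a<..<b}")
      case True
      then have "0 < bump a b t" by (simp add: bump_pos_iff)
      then have "norm (1 - bump a b t) < 1" 
        using bump_range(2)[of a b t] unfolding real_norm_def by linarith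
      then have "(\<lambda>j. (1 - bump a b t) ^ j) \<longlonglongrightarrow> 0" by (rule LIMSEQ_power_zero)
      then have "(\<lambda>j. complex_of_real (1 - (1 - bump a b t) ^ j)) \<longlonglongrightarrow> of_real (1 - 0)"
        by (rule tendsto_of_real[OF tendsto_diff[OF tendsto_const]])
      with True show ?thesis by (simp add: eq)
    next
      case False
      then show ?thesis using bump_eq_0_iff[of a b t] by (auto simp: eq indicator_def)
    qed
  qed
qed

lemma derivative_chain_zero_outside:
  assumes F: "derivative_chain F" and K: "closed K" and "\<And>t. t \<notin> K \<Longrightarrow> F 0 t = 0"
  shows "t \<notin> K \<Longrightarrow> F n t = 0"
proof (induction n arbitrary: t)
  case 0
  then show ?case using assms by auto
next
  case (Suc n)
  have "(F n has_vector_derivative 0) (at t)"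
    by (rule has_vector_derivative_transform_within_open[of "\<lambda>_. 0" _ _ "- K"])
      (use K Suc in auto)
  then show ?case using F vector_derivative_unique_at unfolding derivative_chain_def by blast
qed

lemma derivative_chain_bounded:
  assumes F: "derivative_chain F" and K: "compact K" and "\<And>t. t \<notin> K \<Longrightarrow> F 0 t = 0"
  shows "\<exists>M. \<forall>t. norm (F n t) \<le> M"
proof -
  have "continuous_on K (F n)" using F
    by (auto simp: derivative_chain_def intro!: continuous_at_imp_continuous_on has_vector_derivative_continuous)
  then have "bounded (F n ` K)" by (intro compact_imp_bounded compact_continuous_image K)
  then obtain M where "\<And>t. t \<in> K \<Longrightarrow> norm (F n t) \<le> M" by (auto simp: bounded_iff)
  moreover have "F n t = 0" if "t \<notin> K" for t
    using derivative_chain_zero_outside[OF F compact_imp_closed[OF K] assms(3) that] by blast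
  ultimately have "norm (F n t) \<le> max M 0" for t
    by (cases "t \<in> K") (simp_all add: le_max_iff_disj)
  then show ?thesis by blast
qed

section \<open>Integration by parts\<close>

lemma continuous_measurable_lebesgue_on:
  fixes f :: "real^3 \<Rightarrow> 'a::euclidean_space"
  assumes "continuous_on UNIV f"
  shows "f \<in> borel_measurable (lebesgue_on \<Omega>)"
  using borel_measurable_continuous_onI[OF assms]
  by (intro measurable_restrict_space1 measurable_completion) simp

lemma integrable_lborel_compact_support:
  fixes f :: "real^3 \<Rightarrow> 'a::euclidean_space"
  assumes f: "continuous_on UNIV f" and K: "compact K" "\<And>x. x \<notin> K \<Longrightarrow> f x = 0"
  shows "integrable lborel f"
proof -
  have "integrable lborel (\<lambda>x. indicator K x *\<^sub>R f x)"
    by (rule borel_integrable_compact[OF K(1)]) (use f continuous_on_subset in blast)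
  also have "(\<lambda>x. indicator K x *\<^sub>R f x) = f"
    using K(2) by (auto simp: indicator_def fun_eq_iff)
  finally show ?thesis .
qed

lemma lebesgue_on_integral_eq_lborel:
  fixes f :: "real^3 \<Rightarrow> 'a::euclidean_space"
  assumes \<Omega>: "open \<Omega>" and f: "f \<in> borel_measurable borel" and off: "\<And>x. x \<notin> \<Omega> \<Longrightarrow> f x = 0"
  shows "integral\<^sup>L (lebesgue_on \<Omega>) f = integral\<^sup>L lborel f"
    and "integrable (lebesgue_on \<Omega>) f \<longleftrightarrow> integrable lborel f"
proof -
  have "(\<lambda>x. indicator \<Omega> x *\<^sub>R f x) = f"
    using off by (auto simp: indicator_def fun_eq_iff)
  then show "integral\<^sup>L (lebesgue_on \<Omega>) f = integral\<^sup>L lborel f"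
    "integrable (lebesgue_on \<Omega>) f \<longleftrightarrow> integrable lborel f"
    using \<Omega> f by (simp_all add: integral_restrict_space integrable_restrict_space integral_completion integrable_completion)
qed

lemma indicator_lebesgue_on:
  assumes \<Omega>: "open \<Omega>" and A: "A \<in> sets borel" "emeasure lborel A < \<infinity>" "A \<subseteq> \<Omega>"
  shows "integrable (lebesgue_on \<Omega>) (indicator A :: real^3 \<Rightarrow> real)"
    and "integral\<^sup>L (lebesgue_on \<Omega>) (indicator A :: real^3 \<Rightarrow> real) = measure lborel A"
proof -
  have *: "integrable lborel (indicator A :: real^3 \<Rightarrow> real)"
    using A by (intro integrable_real_indicator) auto
  have 0: "indicator A x = (0 :: real)" if "x \<notin> \<Omega>" for x
    using that A(3) by (auto simp: indicator_def)
  have m: "(indicator A :: real^3 \<Rightarrow> real) \<in> borel_measurable borel" using A(1) by simp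
  show "integrable (lebesgue_on \<Omega>) (indicator A :: real^3 \<Rightarrow> real)"
    using lebesgue_on_integral_eq_lborel(2)[OF \<Omega> m 0] * by blast
  show "integral\<^sup>L (lebesgue_on \<Omega>) (indicator A :: real^3 \<Rightarrow> real) = measure lborel A"
    using lebesgue_on_integral_eq_lborel(1)[OF \<Omega> m 0] by simp
qed

lemma integrable_compact_support:
  fixes f :: "real^3 \<Rightarrow> 'a::euclidean_space"
  assumes \<Omega>: "open \<Omega>" and f: "continuous_on UNIV f"
    and K: "compact K" "\<And>x. x \<notin> K \<Longrightarrow> f x = 0" "K \<subseteq> \<Omega>"
  shows "integrable (lebesgue_on \<Omega>) f"
proof -
  have "integrable lborel f" using integrable_lborel_compact_support[OF f K(1,2)] by blast
  moreover have "\<And>x. x \<notin> \<Omega> \<Longrightarrow> f x = 0" using K by blast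
  ultimately show ?thesis
    using lebesgue_on_integral_eq_lborel(2)[OF \<Omega> borel_measurable_continuous_onI[OF f]] by blast
qed

lemma test_functions_bounded:
  assumes "f \<in> test_functions \<Omega>"
  shows "\<exists>M. \<forall>x. norm (f x) \<le> M"
proof -
  obtain K where K: "compact K" "K \<subseteq> \<Omega>" "\<And>x. x \<notin> K \<Longrightarrow> f x = 0"
    using test_functionsE[OF assms] by blast
  have "bounded (f ` K)"
    by (intro compact_imp_bounded compact_continuous_image K
        continuous_on_subset[OF test_functions_continuous[OF assms]]) simp
  then obtain M where "\<And>t. t \<in> K \<Longrightarrow> norm (f t) \<le> M" by (auto simp: bounded_iff)
  then have "norm (f t) \<le> max M 0" for t
    using K(3) by (cases "t \<in> K") (simp_all add: le_max_iff_disj)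
  then show ?thesis by blast
qed

lemma test_functions_Lp:
  fixes f :: "real^3 \<Rightarrow> 'a::euclidean_space"
  assumes \<Omega>: "open \<Omega>" and f: "f \<in> test_functions \<Omega>" and "p > 0"
  shows "f \<in> Lp p \<Omega>"
proof -
  obtain K where K: "compact K" "K \<subseteq> \<Omega>" "\<And>x. x \<notin> K \<Longrightarrow> f x = 0"
    using test_functionsE[OF f] by blast
  have "integrable (lebesgue_on \<Omega>) (\<lambda>x. norm (f x) ^ p)"
    by (rule integrable_compact_support[OF \<Omega> _ K(1) _ K(2)])
      (use K(3) \<open>p > 0\<close> in \<open>auto intro!: continuous_intros test_functions_continuous[OF f]\<close>)
  then show ?thesis
    unfolding Lp_def using continuous_measurable_lebesgue_on[OF test_functions_continuous[OF f]] by simp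
qed

lemma integrable_test_mult:
  fixes f g :: scalar_field
  assumes \<Omega>: "open \<Omega>" and f: "f \<in> test_functions \<Omega>" and g: "g \<in> test_functions \<Omega>"
  shows "integrable (lebesgue_on \<Omega>) (\<lambda>x. f x * g x)"
proof -
  obtain K where K: "compact K" "K \<subseteq> \<Omega>" "\<And>x. x \<notin> K \<Longrightarrow> f x = 0"
    using test_functionsE[OF f] by blast
  show ?thesis
    by (rule integrable_compact_support[OF \<Omega> _ K(1) _ K(2)])
      (use K(3) in \<open>auto intro!: continuous_intros test_functions_continuous[OF f] test_functions_continuous[OF g]\<close>)
qed

text \<open>
  The integral of \<open>F(x + h e) - F(x)\<close> vanishes by translation invariance of the Lebesgue measure. Dividing by
  \<open>h\<close> and letting \<open>h \<rightarrow> 0\<close> gives the claim by dominated convergence: by the mean value inequality the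
  quotients are bounded by the supremum of the derivative, and for \<open>h \<le> 1\<close> they vanish outside a fixed ball.
\<close>
lemma integral_partial_deriv_eq_0:
  fixes F :: "real^3 \<Rightarrow> 'a::euclidean_space"
  assumes diff: "\<And>x. F differentiable (at x)" and cont: "continuous_on UNIV (partial_deriv i F)"
    and K: "compact K" "\<And>x. x \<notin> K \<Longrightarrow> F x = 0"
  shows "integral\<^sup>L lborel (partial_deriv i F) = 0"
proof -
  let ?D = "partial_deriv i F" and ?e = "axis i 1 :: real^3"
  have contF: "continuous_on UNIV F"
    using diff by (auto intro!: continuous_at_imp_continuous_on differentiable_imp_continuous_within)
  have D0: "?D x = 0" if "x \<notin> K" for x
    by (rule partial_deriv_zero_off_closed[OF compact_imp_closed[OF K(1)] K(2) that])
  have line: "((\<lambda>s. F (x + s *\<^sub>R ?e)) has_vector_derivative ?D (x + s *\<^sub>R ?e)) (at s)" for x s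
  proof -
    have 1: "((\<lambda>s. x + s *\<^sub>R ?e) has_derivative (\<lambda>h. h *\<^sub>R ?e)) (at s)"
      by (auto intro!: derivative_eq_intros)
    have 2: "(F has_derivative frechet_derivative F (at (x + s *\<^sub>R ?e))) (at (x + s *\<^sub>R ?e))"
      using diff frechet_derivative_works by blast
    have "((\<lambda>s. F (x + s *\<^sub>R ?e)) has_derivative
        (\<lambda>h. frechet_derivative F (at (x + s *\<^sub>R ?e)) (h *\<^sub>R ?e))) (at s)"
      by (rule has_derivative_compose[OF 1 2])
    then show ?thesis
      by (simp add: has_vector_derivative_def partial_deriv_def
          linear_scale[OF has_derivative_linear[OF 2]])
  qed
  have "bounded (?D ` K)"
    by (intro compact_imp_bounded compact_continuous_image K continuous_on_subset[OF cont]) simp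
  then obtain M where M0: "\<And>x. x \<in> K \<Longrightarrow> norm (?D x) \<le> M" by (auto simp: bounded_iff)
  define B where "B = max M 0"
  have M: "norm (?D x) \<le> B" for x
    using M0[of x] D0[of x] by (cases "x \<in> K") (auto simp: B_def)
  obtain R where R: "\<And>x. x \<in> K \<Longrightarrow> norm x \<le> R"
    using compact_imp_bounded[OF K(1)] by (auto simp: bounded_iff)
  \<comment> \<open>the difference quotients for the step 1/(n + 1)\<close>
  define q where "q n x = real (Suc n) *\<^sub>R (F (x + (1 / real (Suc n)) *\<^sub>R ?e) - F x)" for n x
  have q_bound: "norm (q n x) \<le> B * indicator (cball 0 (R + 1)) x" for n x
  proof (cases "x \<in> cball 0 (R + 1)")
    case True
    have "norm (F (x + (1 / real (Suc n)) *\<^sub>R ?e) - F (x + 0 *\<^sub>R ?e)) \<le> B * norm (1 / real (Suc n) - 0)"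
    proof (rule differentiable_bound[where f="\<lambda>s. F (x + s *\<^sub>R ?e)" and S=UNIV and f'="\<lambda>s h. h *\<^sub>R ?D (x + s *\<^sub>R ?e)"])
      show "((\<lambda>s. F (x + s *\<^sub>R ?e)) has_derivative (\<lambda>h. h *\<^sub>R ?D (x + s *\<^sub>R ?e))) (at s within UNIV)" for s
        using line by (simp add: has_vector_derivative_def)
      show "onorm (\<lambda>h. h *\<^sub>R ?D (x + s *\<^sub>R ?e)) \<le> B" for s
        using mult_right_mono[OF M abs_ge_zero] by (intro onorm_le) (simp add: mult.commute)
    qed auto
    then have "real (Suc n) * norm (F (x + (1 / real (Suc n)) *\<^sub>R ?e) - F x) \<le> B"
      by (simp add: field_simps del: of_nat_Suc)
    moreover have "norm (q n x) = real (Suc n) * norm (F (x + (1 / real (Suc n)) *\<^sub>R ?e) - F x)"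
      by (simp only: q_def norm_scaleR abs_of_nat)
    ultimately show ?thesis using True by simp
  next
    case False
    have "x \<notin> K" using False R[of x] by (auto simp: dist_norm)
    moreover have "x + (1 / real (Suc n)) *\<^sub>R ?e \<notin> K"
    proof
      assume "x + (1 / real (Suc n)) *\<^sub>R ?e \<in> K"
      then have "norm (x + (1 / real (Suc n)) *\<^sub>R ?e) \<le> R" by (rule R)
      moreover have "norm x \<le> norm (x + (1 / real (Suc n)) *\<^sub>R ?e) + norm ((1 / real (Suc n)) *\<^sub>R ?e)"
        using norm_triangle_ineq4[of "x + (1 / real (Suc n)) *\<^sub>R ?e" "(1 / real (Suc n)) *\<^sub>R ?e"] by simp
      moreover have "norm ((1 / real (Suc n)) *\<^sub>R ?e) \<le> 1" by simp
      moreover have "norm x > R + 1" using False by simp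
      ultimately show False by linarith
    qed
    moreover have "0 \<le> B" by (simp add: B_def)
    ultimately show ?thesis using K(2) by (simp add: q_def)
  qed
  have q_lim: "(\<lambda>n. q n x) \<longlonglongrightarrow> ?D x" for x
  proof -
    have "((\<lambda>h. (F (x + h *\<^sub>R ?e) - F x) /\<^sub>R h) \<longlongrightarrow> ?D x) (at 0)"
    proof (rule Lim_null[THEN iffD2], rule tendsto_norm_zero_cancel)
      have "((\<lambda>h. norm (F (x + h *\<^sub>R ?e) - F x - h *\<^sub>R ?D x) / norm h) \<longlongrightarrow> 0) (at 0)"
        using line[of x 0] by (simp add: has_vector_derivative_def has_derivative_at)
      moreover have "\<forall>\<^sub>F h in at 0. norm (F (x + h *\<^sub>R ?e) - F x - h *\<^sub>R ?D x) / norm h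
          = norm ((F (x + h *\<^sub>R ?e) - F x) /\<^sub>R h - ?D x)"
        using eventually_neq_at_within[of 0 0 UNIV]
      proof eventually_elim
        case (elim h)
        then have "(F (x + h *\<^sub>R ?e) - F x) /\<^sub>R h - ?D x = (F (x + h *\<^sub>R ?e) - F x - h *\<^sub>R ?D x) /\<^sub>R h"
          by (simp add: scaleR_diff_right)
        then show ?case by (simp only: norm_scaleR) (simp add: divide_inverse)
      qed
      ultimately show "((\<lambda>h. norm ((F (x + h *\<^sub>R ?e) - F x) /\<^sub>R h - ?D x)) \<longlongrightarrow> 0) (at 0)"
        using tendsto_cong by fast
    qed
    moreover have "filterlim (\<lambda>n. 1 / real (Suc n)) (at 0) sequentially"
      unfolding filterlim_at using LIMSEQ_Suc[OF lim_1_over_n] by auto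
    ultimately show ?thesis
      using filterlim_compose[of "\<lambda>h. (F (x + h *\<^sub>R ?e) - F x) /\<^sub>R h" "nhds (?D x)" "at 0"
        "\<lambda>n. 1 / real (Suc n)" sequentially]
      by (simp add: q_def del: of_nat_Suc)
  qed
  have intF: "integrable lborel F"
    by (rule integrable_lborel_compact_support[OF contF K])
  have shift: "integrable lborel (\<lambda>x. F (x + a))" "integral\<^sup>L lborel (\<lambda>x. F (x + a)) = integral\<^sup>L lborel F" for a
  proof -
    have m: "(+) a \<in> borel_measurable lborel" "F \<in> borel_measurable borel"
      using borel_measurable_continuous_onI[OF contF] by simp_all
    have "integrable (distr lborel borel ((+) a)) F" using intF by (simp add: lborel_distr_plus)
    then show "integrable lborel (\<lambda>x. F (x + a))"
      using integrable_distr_eq[OF m] by (simp add: add.commute)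
    show "integral\<^sup>L lborel (\<lambda>x. F (x + a)) = integral\<^sup>L lborel F"
      using integral_distr[OF m] by (simp add: lborel_distr_plus add.commute)
  qed
  have "integral\<^sup>L lborel (q n) = 0" for n
    using shift[of "(1 / real (Suc n)) *\<^sub>R ?e"] intF
    unfolding q_def[abs_def] by (simp del: of_nat_Suc)
  moreover have "(\<lambda>n. integral\<^sup>L lborel (q n)) \<longlonglongrightarrow> integral\<^sup>L lborel ?D"
  proof (rule integral_dominated_convergence[where w="\<lambda>x. B * indicator (cball 0 (R + 1)) x"])
    show "?D \<in> borel_measurable lborel" using borel_measurable_continuous_onI[OF cont] by simp
    have cont_q: "continuous_on UNIV (q n)" for n
      unfolding q_def[abs_def]
      by (intro continuous_intros continuous_on_compose2[OF contF]) auto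
    show "q n \<in> borel_measurable lborel" for n
      using borel_measurable_continuous_onI[OF cont_q] by simp
    show "integrable lborel (\<lambda>x :: real^3. B * indicator (cball 0 (R + 1)) x)"
      using emeasure_lborel_cball_finite[of "0 :: real^3" "R + 1"]
      by (intro integrable_mult_right integrable_real_indicator) (auto simp: top.not_eq_extremum)
    show "AE x in lborel. (\<lambda>n. q n x) \<longlonglongrightarrow> ?D x" using q_lim by simp
    show "AE x in lborel. norm (q n x) \<le> B * indicator (cball 0 (R + 1)) x" for n using q_bound by simp
  qed
  ultimately have "(\<lambda>n. 0) \<longlonglongrightarrow> integral\<^sup>L lborel ?D" by simp
  then show ?thesis using LIMSEQ_unique[OF tendsto_const] by metis
qed

lemma partial_deriv_mult:
  fixes f g :: scalar_field
  assumes "f differentiable (at x)" "g differentiable (at x)"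
  shows "partial_deriv i (\<lambda>x. f x * g x) x = f x * partial_deriv i g x + partial_deriv i f x * g x"
  using partial_deriv_eqI[OF has_derivative_mult[OF assms[unfolded frechet_derivative_works]]]
  by (simp add: partial_deriv_def)

lemma integration_by_parts:
  fixes f g :: scalar_field
  assumes \<Omega>: "open \<Omega>" and f: "f \<in> test_functions \<Omega>" and g: "g \<in> test_functions \<Omega>"
  shows "integral\<^sup>L (lebesgue_on \<Omega>) (\<lambda>x. f x * partial_deriv i g x)
    = - integral\<^sup>L (lebesgue_on \<Omega>) (\<lambda>x. partial_deriv i f x * g x)"
proof -
  let ?F = "\<lambda>x. f x * g x"
  obtain K where K: "compact K" "K \<subseteq> \<Omega>" "\<And>x. x \<notin> K \<Longrightarrow> f x = 0"
    using test_functionsE[OF f] by blast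
  have eq: "partial_deriv i ?F = (\<lambda>x. f x * partial_deriv i g x + partial_deriv i f x * g x)"
    by (intro ext partial_deriv_mult test_functions_differentiable[OF f] test_functions_differentiable[OF g])
  have cont: "continuous_on UNIV (partial_deriv i ?F)"
    unfolding eq by (intro continuous_intros test_functions_continuous[of _ \<Omega>] f g test_functions_partial_deriv)
  have "integral\<^sup>L lborel (partial_deriv i ?F) = 0"
  proof (rule integral_partial_deriv_eq_0[OF _ cont K(1)])
    show "?F differentiable (at x)" for x
      by (intro differentiable_mult test_functions_differentiable[OF f] test_functions_differentiable[OF g])
  qed (simp add: K(3))
  also have "integral\<^sup>L lborel (partial_deriv i ?F) = integral\<^sup>L (lebesgue_on \<Omega>) (partial_deriv i ?F)"
    using borel_measurable_continuous_onI[OF cont] test_functions_zero_outside f g 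
    by (intro lebesgue_on_integral_eq_lborel(1)[OF \<Omega>, symmetric]) (auto simp: eq test_functions_zero_outside[OF test_functions_partial_deriv])
  finally show ?thesis
    unfolding eq
    by (subst (asm) Bochner_Integration.integral_add)
      (use \<Omega> f g in \<open>auto intro!: integrable_test_mult test_functions_partial_deriv simp: eq_neg_iff_add_eq_0\<close>)
qed

section \<open>Square integrable fields\<close>

lemma Lp_measurable: "f \<in> Lp p \<Omega> \<Longrightarrow> f \<in> borel_measurable (lebesgue_on \<Omega>)"
  by (simp add: Lp_def)

lemma Lp_integrable: "f \<in> Lp p \<Omega> \<Longrightarrow> integrable (lebesgue_on \<Omega>) (\<lambda>x. norm (f x) ^ p)"
  by (simp add: Lp_def)

text \<open>
  Domination by a square integrable function; this reduces components, cut-offs and the like to a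
  pointwise comparison of norms.
\<close>
lemma Lp_2_bound:
  assumes f: "f \<in> borel_measurable (lebesgue_on \<Omega>)" and g: "g \<in> Lp 2 \<Omega>"
    and le: "\<And>x. norm (f x) \<le> norm (g x)"
  shows "f \<in> Lp 2 \<Omega>"
proof -
  have "integrable (lebesgue_on \<Omega>) (\<lambda>x. (norm (f x))\<^sup>2)"
    by (rule Bochner_Integration.integrable_bound[OF Lp_integrable[OF g]])
      (use f le in \<open>auto intro!: power_mono\<close>)
  then show ?thesis using f by (simp add: Lp_def)
qed

lemma Lp_2_add:
  assumes f: "f \<in> Lp 2 \<Omega>" and g: "g \<in> Lp 2 \<Omega>"
  shows "(\<lambda>x. f x + g x) \<in> Lp 2 \<Omega>"
proof -
  have "integrable (lebesgue_on \<Omega>) (\<lambda>x. (norm (f x + g x))\<^sup>2)"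
  proof (rule Bochner_Integration.integrable_bound)
    show "integrable (lebesgue_on \<Omega>) (\<lambda>x. 2 * (norm (f x))\<^sup>2 + 2 * (norm (g x))\<^sup>2)"
      using Lp_integrable[OF f] Lp_integrable[OF g] by simp
    show "AE x in lebesgue_on \<Omega>. norm ((norm (f x + g x))\<^sup>2) \<le> norm (2 * (norm (f x))\<^sup>2 + 2 * (norm (g x))\<^sup>2)"
    proof (rule AE_I2)
      fix x
      have "(norm (f x + g x))\<^sup>2 \<le> (norm (f x) + norm (g x))\<^sup>2"
        by (intro power_mono norm_triangle_ineq) simp
      also have "\<dots> \<le> 2 * (norm (f x))\<^sup>2 + 2 * (norm (g x))\<^sup>2"
        using sum_squares_bound[of "norm (f x)" "norm (g x)"] by (simp add: power2_sum)
      finally show "norm ((norm (f x + g x))\<^sup>2) \<le> norm (2 * (norm (f x))\<^sup>2 + 2 * (norm (g x))\<^sup>2)"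
        by simp
    qed
    show "(\<lambda>x. (norm (f x + g x))\<^sup>2) \<in> borel_measurable (lebesgue_on \<Omega>)"
      using Lp_measurable[OF f] Lp_measurable[OF g] by measurable
  qed
  then show ?thesis using Lp_measurable[OF f] Lp_measurable[OF g] by (simp add: Lp_def)
qed

lemma vec_nth_measurable:
  fixes f :: "'x \<Rightarrow> 'a::euclidean_space^3"
  assumes "f \<in> borel_measurable M"
  shows "(\<lambda>x. f x $ i) \<in> borel_measurable M"
  using measurable_compose[OF assms borel_measurable_continuous_onI[of "\<lambda>v. v $ i"]]
  by (simp add: linear_continuous_on bounded_linear_vec_nth)

lemma Lp_2_component:
  fixes f :: "real^3 \<Rightarrow> 'a::euclidean_space^3"
  assumes "f \<in> Lp 2 \<Omega>"
  shows "(\<lambda>x. f x $ i) \<in> Lp 2 \<Omega>"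
  by (rule Lp_2_bound[OF _ assms]) (use vec_nth_measurable[OF Lp_measurable[OF assms]] Finite_Cartesian_Product.norm_nth_le in auto)

lemma vector_scale_measurable:
  fixes f :: "'x \<Rightarrow> complex^3"
  assumes "f \<in> borel_measurable M"
  shows "(\<lambda>x. c *s f x) \<in> borel_measurable M"
proof -
  have "bounded_linear (\<lambda>v :: complex^3. c *s v)"
    by (rule linear_conv_bounded_linear[THEN iffD1], standard) (auto simp: vec_eq_iff algebra_simps)
  then show ?thesis
    using measurable_compose[OF assms borel_measurable_continuous_onI] linear_continuous_on by blast
qed

lemma norm_vector_scale: "norm (c *s (v :: complex^3)) = cmod c * norm v"
  by (simp add: norm_vec_def norm_mult L2_set_right_distrib)

lemma Lp_2_scale:
  assumes "f \<in> Lp 2 \<Omega>"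
  shows "(\<lambda>x. c *s f x :: complex^3) \<in> Lp 2 \<Omega>"
  using vector_scale_measurable[OF Lp_measurable[OF assms]] Lp_integrable[OF assms]
  by (simp add: Lp_def norm_vector_scale power_mult_distrib)

lemma vector_scale_uminus: "(-1 :: complex) *s (v :: complex^3) = - v"
  by (simp add: vec_eq_iff)

lemma Lp_2_diff:
  fixes f g :: vector_field
  assumes f: "f \<in> Lp 2 \<Omega>" and g: "g \<in> Lp 2 \<Omega>"
  shows "(\<lambda>x. f x - g x) \<in> Lp 2 \<Omega>"
  using Lp_2_add[OF f Lp_2_scale[OF g, of "-1"]] by (simp add: vector_scale_uminus)

lemma Lp_2_mult_integrable:
  fixes f g :: "real^3 \<Rightarrow> 'a::{euclidean_space, real_normed_algebra}"
  assumes f: "f \<in> Lp 2 \<Omega>" and g: "g \<in> Lp 2 \<Omega>"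
  shows "integrable (lebesgue_on \<Omega>) (\<lambda>x. f x * g x)"
proof (rule Bochner_Integration.integrable_bound)
  show "integrable (lebesgue_on \<Omega>) (\<lambda>x. (norm (f x))\<^sup>2 + (norm (g x))\<^sup>2)"
    using Lp_integrable[OF f] Lp_integrable[OF g] by simp
  show "(\<lambda>x. f x * g x) \<in> borel_measurable (lebesgue_on \<Omega>)"
    using Lp_measurable[OF f] Lp_measurable[OF g] by measurable
  show "AE x in lebesgue_on \<Omega>. norm (f x * g x) \<le> norm ((norm (f x))\<^sup>2 + (norm (g x))\<^sup>2)"
  proof (rule AE_I2)
    fix x
    have "0 \<le> norm (f x) * norm (g x)" by simp
    with sum_squares_bound[of "norm (f x)" "norm (g x)"] norm_mult_ineq[of "f x" "g x"]
    have "norm (f x * g x) \<le> (norm (f x))\<^sup>2 + (norm (g x))\<^sup>2" by linarith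
    then show "norm (f x * g x) \<le> norm ((norm (f x))\<^sup>2 + (norm (g x))\<^sup>2)" by simp
  qed
qed

lemma Lp_2_norm: "f \<in> Lp 2 \<Omega> \<Longrightarrow> (\<lambda>x. norm (f x)) \<in> Lp 2 \<Omega>"
  using measurable_compose[OF Lp_measurable borel_measurable_norm] by (simp add: Lp_def)

lemma Lp_2_cnj: "f \<in> Lp 2 \<Omega> \<Longrightarrow> (\<lambda>x. cnj (f x)) \<in> Lp 2 \<Omega>"
  using borel_measurable_continuous_onI[of cnj] continuous_on_cnj[OF continuous_on_id]
  by (auto simp: Lp_def id_def intro: measurable_compose)

lemma Lp_2_inner_integrable:
  fixes u v :: vector_field
  assumes "u \<in> Lp 2 \<Omega>" "v \<in> Lp 2 \<Omega>"
  shows "integrable (lebesgue_on \<Omega>) (\<lambda>x. u x $ i * cnj (v x $ i))"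
  by (intro Lp_2_mult_integrable Lp_2_cnj Lp_2_component assms)

lemma L2_inner_eq_sum:
  assumes "u \<in> Lp 2 \<Omega>" "v \<in> Lp 2 \<Omega>"
  shows "L2_inner \<Omega> u v = (\<Sum>i\<in>UNIV. integral\<^sup>L (lebesgue_on \<Omega>) (\<lambda>x. u x $ i * cnj (v x $ i)))"
  unfolding L2_inner_def
  by (rule Bochner_Integration.integral_sum) (rule Lp_2_inner_integrable[OF assms])

lemma L2_inner_diff_left:
  assumes "u \<in> Lp 2 \<Omega>" "u' \<in> Lp 2 \<Omega>" "v \<in> Lp 2 \<Omega>"
  shows "L2_inner \<Omega> (\<lambda>x. u x - u' x) v = L2_inner \<Omega> u v - L2_inner \<Omega> u' v"
  using Lp_2_inner_integrable[OF assms(1,3)] Lp_2_inner_integrable[OF assms(2,3)]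
  by (simp add: L2_inner_eq_sum Lp_2_diff assms left_diff_distrib sum_subtractf)

lemma L2_inner_scale_left: "L2_inner \<Omega> (\<lambda>x. c *s u x) v = c * L2_inner \<Omega> u v"
  unfolding L2_inner_def by (simp add: mult.assoc flip: sum_distrib_left)

lemma L2_inner_commute: "L2_inner \<Omega> v u = cnj (L2_inner \<Omega> u v)"
proof -
  have "cnj (L2_inner \<Omega> u v) =
      integral\<^sup>L (lebesgue_on \<Omega>) (\<lambda>x. cnj (\<Sum>i\<in>UNIV. u x $ i * cnj (v x $ i)))"
    unfolding L2_inner_def by (rule Bochner_Integration.integral_cnj[symmetric])
  then show ?thesis by (simp add: L2_inner_def mult.commute)
qed

lemma inner_self_eq_norm: "(\<Sum>i\<in>UNIV. v $ i * cnj (v $ i)) = complex_of_real ((norm (v :: complex^3))\<^sup>2)"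
  by (simp add: norm_vec_def L2_set_def sum_nonneg complex_mult_cnj cmod_power2 flip: of_real_power)

lemma L2_inner_self: "L2_inner \<Omega> u u = complex_of_real ((L2_norm \<Omega> u)\<^sup>2)"
  unfolding L2_inner_def L2_norm_def inner_self_eq_norm integral_complex_of_real by simp

lemma norm_sum_mult_cnj_le: "cmod (\<Sum>i\<in>UNIV. v $ i * cnj (w $ i)) \<le> norm v * norm (w :: complex^3)"
proof -
  have "cmod (\<Sum>i\<in>UNIV. v $ i * cnj (w $ i)) \<le> (\<Sum>i\<in>UNIV. \<bar>cmod (v $ i)\<bar> * \<bar>cmod (w $ i)\<bar>)"
    by (rule norm_sum[THEN order_trans]) (simp add: norm_mult)
  also have "\<dots> \<le> norm v * norm w" unfolding norm_vec_def by (rule L2_set_mult_ineq)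
  finally show ?thesis .
qed

lemma integral_mult_le_sqrt:
  fixes f g :: "'x \<Rightarrow> real"
  assumes [measurable]: "f \<in> borel_measurable M" "g \<in> borel_measurable M"
    and nn: "\<And>x. 0 \<le> f x" "\<And>x. 0 \<le> g x"
    and int: "integrable M (\<lambda>x. (f x)\<^sup>2)" "integrable M (\<lambda>x. (g x)\<^sup>2)" "integrable M (\<lambda>x. f x * g x)"
  shows "integral\<^sup>L M (\<lambda>x. f x * g x)
    \<le> sqrt (integral\<^sup>L M (\<lambda>x. (f x)\<^sup>2)) * sqrt (integral\<^sup>L M (\<lambda>x. (g x)\<^sup>2))"
proof -
  have "(\<integral>\<^sup>+x. ennreal (f x) * ennreal (g x) \<partial>M)\<^sup>2
      \<le> (\<integral>\<^sup>+x. ennreal (f x) ^ 2 \<partial>M) * (\<integral>\<^sup>+x. ennreal (g x) ^ 2 \<partial>M)"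
    by (rule Cauchy_Schwarz_nn_integral) measurable
  then have "ennreal ((integral\<^sup>L M (\<lambda>x. f x * g x))\<^sup>2)
      \<le> ennreal (integral\<^sup>L M (\<lambda>x. (f x)\<^sup>2) * integral\<^sup>L M (\<lambda>x. (g x)\<^sup>2))"
    using nn int
    by (simp add: ennreal_mult[symmetric] ennreal_power nn_integral_eq_integral integral_nonneg_AE)
  then have "(integral\<^sup>L M (\<lambda>x. f x * g x))\<^sup>2
      \<le> integral\<^sup>L M (\<lambda>x. (f x)\<^sup>2) * integral\<^sup>L M (\<lambda>x. (g x)\<^sup>2)"
    by (subst (asm) ennreal_le_iff) (auto intro!: mult_nonneg_nonneg integral_nonneg_AE)
  then show ?thesis
    by (metis real_le_rsqrt real_sqrt_mult)
qed

text \<open>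
  Cauchy-Schwarz, where the norm of \<open>v\<close> is only taken over a set carrying \<open>u\<close>. This localised form yields weak
  convergence of sequences with disjoint supports.
\<close>
lemma L2_inner_le_set:
  assumes u: "u \<in> Lp 2 \<Omega>" and v: "v \<in> Lp 2 \<Omega>" and B: "B \<in> sets lebesgue" and \<Omega>: "open \<Omega>"
    and off: "\<And>x. x \<notin> B \<Longrightarrow> u x = 0"
  shows "cmod (L2_inner \<Omega> u v)
    \<le> L2_norm \<Omega> u * sqrt (integral\<^sup>L (lebesgue_on \<Omega>) (\<lambda>x. indicator B x * (norm (v x))\<^sup>2))"
proof -
  let ?v = "\<lambda>x. indicator B x * norm (v x)"
  have m: "indicator B \<in> borel_measurable (lebesgue_on \<Omega>)"
    using B by (intro measurable_restrict_space1 borel_measurable_indicator)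
  have v': "?v \<in> Lp 2 \<Omega>"
  proof (rule Lp_2_bound[OF _ Lp_2_norm[OF v]])
    show "?v \<in> borel_measurable (lebesgue_on \<Omega>)"
      by (intro borel_measurable_times m measurable_compose[OF Lp_measurable[OF v] borel_measurable_norm])
  qed (simp add: indicator_def)
  have sq: "(?v x)\<^sup>2 = indicator B x * (norm (v x))\<^sup>2" for x by (simp add: indicator_def)
  have "cmod (L2_inner \<Omega> u v) \<le> integral\<^sup>L (lebesgue_on \<Omega>) (\<lambda>x. norm (u x) * ?v x)"
    unfolding L2_inner_def
  proof (rule Bochner_Integration.integral_norm_bound_integral)
    show "integrable (lebesgue_on \<Omega>) (\<lambda>x. \<Sum>i\<in>UNIV. u x $ i * cnj (v x $ i))"
      using Lp_2_inner_integrable[OF u v] by simp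
    show "integrable (lebesgue_on \<Omega>) (\<lambda>x. norm (u x) * ?v x)"
      by (intro Lp_2_mult_integrable Lp_2_norm u v')
    show "cmod (\<Sum>i\<in>UNIV. u x $ i * cnj (v x $ i)) \<le> norm (u x) * ?v x" for x
      using norm_sum_mult_cnj_le[of "u x" "v x"] off[of x] by (cases "x \<in> B") auto
  qed
  also have "\<dots> \<le> sqrt (integral\<^sup>L (lebesgue_on \<Omega>) (\<lambda>x. (norm (u x))\<^sup>2)) *
      sqrt (integral\<^sup>L (lebesgue_on \<Omega>) (\<lambda>x. (?v x)\<^sup>2))"
    using Lp_integrable[OF u] Lp_integrable[OF v'] Lp_2_mult_integrable[OF Lp_2_norm[OF u] v']
      Lp_measurable[OF Lp_2_norm[OF u]] Lp_measurable[OF v']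
    by (intro integral_mult_le_sqrt) auto
  finally show ?thesis unfolding L2_norm_def sq .
qed

lemma L2_inner_le:
  assumes u: "u \<in> Lp 2 \<Omega>" and v: "v \<in> Lp 2 \<Omega>" and \<Omega>: "open \<Omega>"
  shows "cmod (L2_inner \<Omega> u v) \<le> L2_norm \<Omega> u * L2_norm \<Omega> v"
  using L2_inner_le_set[OF u v _ \<Omega>, of UNIV] by (simp add: L2_norm_def)

lemma L2_cong_AE:
  assumes "u \<in> Lp 2 \<Omega>" "u' \<in> Lp 2 \<Omega>" "v \<in> Lp 2 \<Omega>" and ae: "AE x in lebesgue_on \<Omega>. u x = u' x"
  shows "L2_inner \<Omega> u v = L2_inner \<Omega> u' v" and "L2_norm \<Omega> u = L2_norm \<Omega> u'"
proof -
  note m = borel_measurable_integrable[OF Lp_2_inner_integrable]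
  show "L2_inner \<Omega> u v = L2_inner \<Omega> u' v"
    unfolding L2_inner_def
    by (rule integral_cong_AE) (use ae assms in \<open>auto intro!: borel_measurable_sum m\<close>)
  show "L2_norm \<Omega> u = L2_norm \<Omega> u'"
    unfolding L2_norm_def
    by (rule arg_cong[where f=sqrt], rule integral_cong_AE)
      (use ae assms in \<open>auto simp: Lp_def\<close>)
qed

section \<open>The fundamental lemma of the calculus of variations\<close>

lemma le_square_plus_1: "t \<le> t\<^sup>2 + (1 :: real)"
proof -
  have "2 * t \<le> t\<^sup>2 + 1" using sum_squares_bound[of t 1] by simp
  then show ?thesis using zero_le_power2[of t] by linarith
qed

text \<open>
  The indicator of a box is the pointwise limit of test functions supported in the closed box, and
  the limit can be taken under the integral because \<open>|w| \<le> |w|\<^sup>2 + 1\<close> is integrable over the box.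
\<close>
lemma integral_over_box_eq_0:
  fixes w :: scalar_field
  assumes \<Omega>: "open \<Omega>" and w: "w \<in> Lp 2 \<Omega>"
    and orth: "\<And>\<phi>. \<phi> \<in> test_functions \<Omega> \<Longrightarrow> integral\<^sup>L (lebesgue_on \<Omega>) (\<lambda>x. w x * \<phi> x) = 0"
    and ab: "cbox a b \<subseteq> \<Omega>"
  shows "integral\<^sup>L (lebesgue_on \<Omega>) (\<lambda>x. w x * indicator (box a b) x) = 0"
proof -
  obtain F where F: "\<And>j. derivative_chain (F j)" "\<And>j t. t \<notin> {a$1<..<b$1} \<Longrightarrow> F j 0 t = 0"
    "\<And>j t. norm (F j 0 t) \<le> 1" "\<And>t. (\<lambda>j. F j 0 t) \<longlonglongrightarrow> indicator {a$1<..<b$1} t"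
    using smooth_interval_indicator[of "a$1" "b$1"] by blast
  obtain G where G: "\<And>j. derivative_chain (G j)" "\<And>j t. t \<notin> {a$2<..<b$2} \<Longrightarrow> G j 0 t = 0"
    "\<And>j t. norm (G j 0 t) \<le> 1" "\<And>t. (\<lambda>j. G j 0 t) \<longlonglongrightarrow> indicator {a$2<..<b$2} t"
    using smooth_interval_indicator[of "a$2" "b$2"] by blast
  obtain H where H: "\<And>j. derivative_chain (H j)" "\<And>j t. t \<notin> {a$3<..<b$3} \<Longrightarrow> H j 0 t = 0"
    "\<And>j t. norm (H j 0 t) \<le> 1" "\<And>t. (\<lambda>j. H j 0 t) \<longlonglongrightarrow> indicator {a$3<..<b$3} t"
    using smooth_interval_indicator[of "a$3" "b$3"] by blast
  define \<phi> where "\<phi> j = tensor (F j 0) (G j 0) (H j 0)" for j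
  have test: "\<phi> j \<in> test_functions \<Omega>" for j
    unfolding \<phi>_def
  proof (rule test_functions_tensor[OF F(1) G(1) H(1) ab])
    show "F j 0 t = 0" if "t \<notin> {a$1..b$1}" for t using that by (intro F(2)) auto
    show "G j 0 t = 0" if "t \<notin> {a$2..b$2}" for t using that by (intro G(2)) auto
    show "H j 0 t = 0" if "t \<notin> {a$3..b$3}" for t using that by (intro H(2)) auto
  qed
  have ind: "(indicator (box a b) x :: complex)
      = indicator {a$1<..<b$1} (x$1) * indicator {a$2<..<b$2} (x$2) * indicator {a$3<..<b$3} (x$3)" for x
    by (simp add: indicator_def mem_box_cart forall_3)
  have lim: "(\<lambda>j. \<phi> j x) \<longlonglongrightarrow> indicator (box a b) x" for x
    unfolding \<phi>_def tensor_def ind by (intro tendsto_mult F(4) G(4) H(4))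
  have bound: "norm (\<phi> j x) \<le> indicator (box a b) x" for j x
  proof (cases "x \<in> box a b")
    case True
    have "norm (\<phi> j x) \<le> 1"
      unfolding \<phi>_def tensor_def norm_mult by (intro mult_le_one mult_nonneg_nonneg F(3) G(3) H(3)) auto
    with True show ?thesis by simp
  next
    case False
    then consider "x$1 \<notin> {a$1<..<b$1}" | "x$2 \<notin> {a$2<..<b$2}" | "x$3 \<notin> {a$3<..<b$3}"
      by (auto simp: mem_box_cart forall_3)
    then show ?thesis by cases (simp_all add: \<phi>_def tensor_def F(2) G(2) H(2))
  qed
  have m: "(indicator (box a b) :: real^3 \<Rightarrow> 'b::{real_normed_algebra_1,second_countable_topology}) \<in> borel_measurable (lebesgue_on \<Omega>)"
    by (intro measurable_restrict_space1 borel_measurable_indicator) simp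
  have ib: "integrable (lebesgue_on \<Omega>) (indicator (box a b) :: real^3 \<Rightarrow> real)"
    using ab box_subset_cbox emeasure_lborel_box_finite by (intro indicator_lebesgue_on(1)[OF \<Omega>]) auto
  have "(\<lambda>j. integral\<^sup>L (lebesgue_on \<Omega>) (\<lambda>x. w x * \<phi> j x)) \<longlonglongrightarrow>
      integral\<^sup>L (lebesgue_on \<Omega>) (\<lambda>x. w x * indicator (box a b) x)"
  proof (rule integral_dominated_convergence[where w="\<lambda>x. (norm (w x))\<^sup>2 + indicator (box a b) x"])
    show "(\<lambda>x. w x * indicator (box a b) x) \<in> borel_measurable (lebesgue_on \<Omega>)"
      by (intro borel_measurable_times Lp_measurable[OF w] m)
    show "(\<lambda>x. w x * \<phi> j x) \<in> borel_measurable (lebesgue_on \<Omega>)" for j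
      by (intro borel_measurable_times Lp_measurable[OF w]
          continuous_measurable_lebesgue_on[OF test_functions_continuous[OF test]])
    show "integrable (lebesgue_on \<Omega>) (\<lambda>x. (norm (w x))\<^sup>2 + indicator (box a b) x)"
      by (intro Bochner_Integration.integrable_add Lp_integrable[OF w] ib)
    show "AE x in lebesgue_on \<Omega>. (\<lambda>j. w x * \<phi> j x) \<longlonglongrightarrow> w x * indicator (box a b) x"
      by (intro AE_I2 tendsto_mult lim tendsto_const)
    show "AE x in lebesgue_on \<Omega>. norm (w x * \<phi> j x) \<le> (norm (w x))\<^sup>2 + indicator (box a b) x" for j
    proof (rule AE_I2)
      fix x
      have "norm (w x) \<le> (norm (w x))\<^sup>2 + 1"
        by (rule le_square_plus_1)
      then show "norm (w x * \<phi> j x) \<le> (norm (w x))\<^sup>2 + indicator (box a b) x"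
        using mult_left_mono[OF bound[of j x], of "norm (w x)"] zero_le_power2[of "norm (w x)"]
        by (cases "x \<in> box a b") (auto simp: norm_mult intro: order_trans)
    qed
  qed
  then show ?thesis
    unfolding orth[OF test] by (simp add: LIMSEQ_const_iff)
qed

text \<open>
  A Dynkin system argument: boxes form an intersection-stable generator of the Borel sets, and the
  sets over which \<open>g\<close> integrates to 0 are closed under complements and countable disjoint unions.
\<close>
lemma integral_over_borel_eq_0:
  fixes g :: "real^3 \<Rightarrow> complex"
  assumes g: "integrable lebesgue g" and total: "integral\<^sup>L lebesgue g = 0"
    and boxes: "\<And>c d. integral\<^sup>L lebesgue (\<lambda>x. indicator (box c d) x *\<^sub>R g x) = 0"
    and A: "A \<in> sets borel"
  shows "integral\<^sup>L lebesgue (\<lambda>x. indicator A x *\<^sub>R g x) = 0"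
proof -
  have int: "integrable lebesgue (\<lambda>x. indicator A x *\<^sub>R g x)" if "A \<in> sets borel" for A
    using that by (intro integrable_mult_indicator g) simp
  have gen: "sets (borel :: (real^3) measure) = sigma_sets UNIV (range (\<lambda>(a, b). box a b))"
    unfolding borel_eq_box by simp
  have stable: "Int_stable (range (\<lambda>(a, b). box a b :: (real^3) set))"
    by (auto simp: Int_stable_def box_Int_box)
  have pow: "range (\<lambda>(a, b). box a b :: (real^3) set) \<subseteq> Pow UNIV" by simp
  from stable pow A[unfolded gen] show ?thesis
  proof (induction rule: sigma_sets_induct_disjoint)
    case (basic A)
    then show ?case using boxes by auto
  next
    case empty
    show ?case by simp
  next
    case (compl A)
    then have "A \<in> sets borel" by (simp add: gen)
    have "integral\<^sup>L lebesgue (\<lambda>x. indicator (UNIV - A) x *\<^sub>R g x)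
        = integral\<^sup>L lebesgue (\<lambda>x. g x - indicator A x *\<^sub>R g x)"
      by (intro Bochner_Integration.integral_cong) (auto simp: indicator_def)
    with compl total int[OF \<open>A \<in> sets borel\<close>] g show ?case by simp
  next
    case (union A)
    then have A: "\<And>i. A i \<in> sets borel" by (auto simp: gen)
    have "(\<lambda>n. integral\<^sup>L lebesgue (\<lambda>x. indicator (\<Union>i<n. A i) x *\<^sub>R g x))
      \<longlonglongrightarrow> integral\<^sup>L lebesgue (\<lambda>x. indicator (\<Union>i. A i) x *\<^sub>R g x)"
    proof (rule integral_dominated_convergence[where w="\<lambda>x. norm (g x)"])
      show "(\<lambda>x. indicator (\<Union>i. A i) x *\<^sub>R g x) \<in> borel_measurable lebesgue"
        by (intro borel_measurable_integrable int) (use A in auto)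
      show "(\<lambda>x. indicator (\<Union>i<n. A i) x *\<^sub>R g x) \<in> borel_measurable lebesgue" for n
        by (intro borel_measurable_integrable int) (use A in auto)
      show "integrable lebesgue (\<lambda>x. norm (g x))" using g by simp
      show "AE x in lebesgue. (\<lambda>n. indicator (\<Union>i<n. A i) x *\<^sub>R g x) \<longlonglongrightarrow> indicator (\<Union>i. A i) x *\<^sub>R g x"
        by (intro AE_I2 tendsto_scaleR LIMSEQ_indicator_UN tendsto_const)
      show "AE x in lebesgue. norm (indicator (\<Union>i<n. A i) x *\<^sub>R g x) \<le> norm (g x)" for n
        by (auto simp: indicator_def)
    qed
    moreover have "integral\<^sup>L lebesgue (\<lambda>x. indicator (\<Union>i<n. A i) x *\<^sub>R g x) = 0" for n
    proof -
      have "indicator (\<Union>i<n. A i) x = (\<Sum>i<n. indicator (A i) x :: real)" for x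
        using union(1) by (intro indicator_UN_disjoint) (auto simp: disjoint_family_on_def)
      then have "integral\<^sup>L lebesgue (\<lambda>x. indicator (\<Union>i<n. A i) x *\<^sub>R g x)
          = integral\<^sup>L lebesgue (\<lambda>x. \<Sum>i<n. indicator (A i) x *\<^sub>R g x)"
        by (simp add: scaleR_sum_left)
      also have "\<dots> = (\<Sum>i<n. integral\<^sup>L lebesgue (\<lambda>x. indicator (A i) x *\<^sub>R g x))"
        by (intro Bochner_Integration.integral_sum int A)
      also have "\<dots> = 0" using union(3) by simp
      finally show ?thesis .
    qed
    ultimately show ?case by (simp add: LIMSEQ_const_iff)
  qed
qed

text \<open>
  Orthogonality to test functions first gives vanishing integrals over all boxes inside a given
  box, then over all Borel and all Lebesgue measurable subsets of it, hence \<open>w = 0\<close> almost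
  everywhere there. Countably many such boxes cover \<open>\<Omega>\<close>.
\<close>
lemma fundamental_lemma_calculus_of_variations:
  fixes w :: scalar_field
  assumes \<Omega>: "open \<Omega>" and w: "w \<in> Lp 2 \<Omega>"
    and orth: "\<And>\<phi>. \<phi> \<in> test_functions \<Omega> \<Longrightarrow> integral\<^sup>L (lebesgue_on \<Omega>) (\<lambda>x. w x * \<phi> x) = 0"
  shows "AE x in lebesgue_on \<Omega>. w x = 0"
proof -
  have on_box: "AE x in lebesgue. x \<in> cbox a b \<longrightarrow> w x = 0" if ab: "cbox a b \<subseteq> \<Omega>" for a b
  proof -
    let ?g = "\<lambda>x. indicator (box a b) x *\<^sub>R w x"
    have "box a b \<subseteq> \<Omega>" using ab box_subset_cbox by blast
    have to_leb: "integral\<^sup>L lebesgue (\<lambda>x. indicator (box c d) x *\<^sub>R w x)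
        = integral\<^sup>L (lebesgue_on \<Omega>) (\<lambda>x. w x * indicator (box c d) x)" if "box c d \<subseteq> \<Omega>" for c d
      using \<Omega> that by (subst integral_restrict_space)
        (auto simp: indicator_def intro!: Bochner_Integration.integral_cong)
    have zero: "integral\<^sup>L lebesgue (\<lambda>x. indicator (box c d) x *\<^sub>R w x) = 0" if "box c d \<subseteq> box a b" for c d
    proof (cases "box c d = {}")
      case False
      moreover from this have "box a b \<noteq> {}" using that by blast
      ultimately have "cbox c d \<subseteq> cbox a b"
        using closure_mono[OF that] by simp
      then show ?thesis
        using integral_over_box_eq_0[OF \<Omega> w orth, of c d] to_leb[of c d] ab that \<open>box a b \<subseteq> \<Omega>\<close> by auto
    qed simp
    have int: "integrable lebesgue ?g"
    proof -
      have "integrable (lebesgue_on \<Omega>) ?g"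
      proof (rule Bochner_Integration.integrable_bound)
        have m: "(indicator (box a b) :: real^3 \<Rightarrow> real) \<in> borel_measurable (lebesgue_on \<Omega>)"
          by (intro measurable_restrict_space1 borel_measurable_indicator) simp
        then show "?g \<in> borel_measurable (lebesgue_on \<Omega>)"
          using Lp_measurable[OF w] by (intro borel_measurable_scaleR)
        have "integrable (lebesgue_on \<Omega>) (indicator (box a b) :: real^3 \<Rightarrow> real)"
          using \<Omega> \<open>box a b \<subseteq> \<Omega>\<close> emeasure_lborel_box_finite by (intro indicator_lebesgue_on(1)) auto
        then show "integrable (lebesgue_on \<Omega>) (\<lambda>x. (norm (w x))\<^sup>2 + indicator (box a b) x)"
          by (intro Bochner_Integration.integrable_add Lp_integrable[OF w])
        show "AE x in lebesgue_on \<Omega>. norm (?g x) \<le> norm ((norm (w x))\<^sup>2 + indicator (box a b) x)"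
        proof (rule AE_I2)
          fix x
          have "norm (w x) \<le> (norm (w x))\<^sup>2 + 1"
            by (rule le_square_plus_1)
          then show "norm (?g x) \<le> norm ((norm (w x))\<^sup>2 + indicator (box a b) x)"
            by (simp add: indicator_def)
        qed
      qed
      then have "integrable lebesgue (\<lambda>x. indicator \<Omega> x *\<^sub>R ?g x)"
        using \<Omega> by (simp add: integrable_restrict_space)
      also have "(\<lambda>x. indicator \<Omega> x *\<^sub>R ?g x) = ?g"
        using \<open>box a b \<subseteq> \<Omega>\<close> by (auto simp: indicator_def fun_eq_iff)
      finally show ?thesis .
    qed
    have borel: "integral\<^sup>L lebesgue (\<lambda>x. indicator A x *\<^sub>R ?g x) = 0" if "A \<in> sets borel" for A
    proof (rule integral_over_borel_eq_0[OF int zero[OF order_refl] _ that])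
      fix c d
      obtain e f where ef: "box c d \<inter> box a b = box e f" by (auto simp: box_Int_box)
      have "integral\<^sup>L lebesgue (\<lambda>x. indicator (box c d) x *\<^sub>R ?g x)
          = integral\<^sup>L lebesgue (\<lambda>x. indicator (box e f) x *\<^sub>R w x)"
        unfolding ef[symmetric] by (intro Bochner_Integration.integral_cong) (auto simp: indicator_def)
      also have "\<dots> = 0" using ef by (intro zero) auto
      finally show "integral\<^sup>L lebesgue (\<lambda>x. indicator (box c d) x *\<^sub>R ?g x) = 0" .
    qed
    have "AE x in lebesgue_on (box a b). ?g x = 0"
    proof (rule sigma_finite_measure.density_zero)
      show "sigma_finite_measure (lebesgue_on (box a b))"
        using finite_measure_lebesgue_on[OF lmeasurable_box] finite_measure.axioms(1) by blast
      show "integrable (lebesgue_on (box a b)) ?g"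
        using integrable_mult_indicator[OF _ int, of "box a b"] by (simp add: integrable_restrict_space)
      fix A assume "A \<in> sets (lebesgue_on (box a b))"
      then have A: "A \<in> sets lebesgue" "A \<subseteq> box a b"
        by (auto simp: sets_restrict_space_iff)
      obtain S N N' where S: "A = S \<union> N" "N \<subseteq> N'" "N' \<in> null_sets lborel" "S \<in> sets lborel"
        using A(1) by (rule sets_completionE)
      have "set_lebesgue_integral (lebesgue_on (box a b)) A ?g = integral\<^sup>L lebesgue (\<lambda>x. indicator A x *\<^sub>R ?g x)"
        unfolding set_lebesgue_integral_def
        by (subst integral_restrict_space) (auto simp: indicator_def intro!: Bochner_Integration.integral_cong)
      also have "\<dots> = integral\<^sup>L lebesgue (\<lambda>x. indicator S x *\<^sub>R ?g x)"
      proof (rule integral_cong_AE)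
        show "(\<lambda>x. indicator A x *\<^sub>R ?g x) \<in> borel_measurable lebesgue"
          by (intro borel_measurable_integrable integrable_mult_indicator A int)
        show "(\<lambda>x. indicator S x *\<^sub>R ?g x) \<in> borel_measurable lebesgue"
          using S(4) by (intro borel_measurable_integrable integrable_mult_indicator int) simp
        show "AE x in lebesgue. indicator A x *\<^sub>R ?g x = indicator S x *\<^sub>R ?g x"
          using AE_completion[OF AE_not_in[OF S(3)]]
          by eventually_elim (use S(1,2) in \<open>auto simp: indicator_def\<close>)
      qed
      also have "\<dots> = 0" using S(4) by (intro borel) simp
      finally show "set_lebesgue_integral (lebesgue_on (box a b)) A ?g = 0" .
    qed
    then have "AE x in lebesgue. x \<in> box a b \<longrightarrow> ?g x = 0"
      by (simp add: AE_restrict_space_iff)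
    moreover have "AE x in lebesgue. x \<notin> cbox a b - box a b"
      by (rule AE_completion[OF AE_not_in[OF null_sets_cbox_Diff_box]])
    ultimately show ?thesis by eventually_elim auto
  qed
  obtain \<D> where D: "countable \<D>" "\<D> \<subseteq> Pow \<Omega>" "\<And>X. X \<in> \<D> \<Longrightarrow> \<exists>a b. X = cbox a b" "\<Union>\<D> = \<Omega>"
    using open_countable_Union_open_cbox[OF \<Omega>] by blast
  have "AE x in lebesgue. \<forall>X\<in>\<D>. x \<in> X \<longrightarrow> w x = 0"
  proof (rule AE_ball_countable'[OF _ D(1)])
    fix X assume "X \<in> \<D>"
    then show "AE x in lebesgue. x \<in> X \<longrightarrow> w x = 0" using D(2,3) on_box by blast
  qed
  then have "AE x in lebesgue. x \<in> \<Omega> \<longrightarrow> w x = 0"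
    by eventually_elim (use D(4) in blast)
  then show ?thesis using \<Omega> by (simp add: AE_restrict_space_iff)
qed

section \<open>Test fields in the domain of the Maxwell operator\<close>

text \<open>
  The difference of two weak curls is orthogonal to every test field, in particular to those with a
  single nonzero component, so the fundamental lemma applies to each of its components.
\<close>
lemma weak_curl_AE_unique:
  assumes \<Omega>: "open \<Omega>" and w: "w \<in> Lp 2 \<Omega>" "has_weak_curl \<Omega> u w"
    and w': "w' \<in> Lp 2 \<Omega>" "has_weak_curl \<Omega> u w'"
  shows "AE x in lebesgue_on \<Omega>. w x = w' x"
proof -
  let ?d = "\<lambda>x. w x - w' x"
  have d: "?d \<in> Lp 2 \<Omega>" by (rule Lp_2_diff[OF w(1) w'(1)])
  have "AE x in lebesgue_on \<Omega>. ?d x $ i = 0" for i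
  proof (rule fundamental_lemma_calculus_of_variations[OF \<Omega> Lp_2_component[OF d]])
    fix \<phi> :: scalar_field assume \<phi>: "\<phi> \<in> test_functions \<Omega>"
    let ?\<psi> = "\<lambda>x. axis i (cnj (\<phi> x)) :: complex^3"
    have \<psi>: "?\<psi> \<in> test_functions \<Omega>"
      by (intro test_functions_linear[OF bounded_linear_axis] test_functions_linear[OF bounded_linear_cnj] \<phi>)
    have "integral\<^sup>L (lebesgue_on \<Omega>) (\<lambda>x. ?d x $ i * \<phi> x) = L2_inner \<Omega> ?d ?\<psi>"
      unfolding L2_inner_def axis_def by (simp add: if_distrib[of cnj] if_distrib[of "\<lambda>z. _ * z"] cong: if_cong)
    also have "\<dots> = L2_inner \<Omega> w ?\<psi> - L2_inner \<Omega> w' ?\<psi>"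
      by (rule L2_inner_diff_left[OF w(1) w'(1) test_functions_Lp[OF \<Omega> \<psi>]]) simp
    also have "\<dots> = 0"
      using w(2) w'(2) \<psi> unfolding has_weak_curl_def by force
    finally show "integral\<^sup>L (lebesgue_on \<Omega>) (\<lambda>x. ?d x $ i * \<phi> x) = 0" .
  qed
  then have "AE x in lebesgue_on \<Omega>. \<forall>i\<in>UNIV. ?d x $ i = 0"
    by (intro AE_ball_countable') auto
  then show ?thesis by eventually_elim (simp add: vec_eq_iff)
qed

lemma weak_curl_spec:
  assumes "u \<in> H_curl \<Omega>"
  shows "weak_curl \<Omega> u \<in> Lp 2 \<Omega>" "has_weak_curl \<Omega> u (weak_curl \<Omega> u)"
proof -
  have "\<exists>w. w \<in> Lp 2 \<Omega> \<and> has_weak_curl \<Omega> u w" using assms by (auto simp: H_curl_def)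
  from someI_ex[OF this] show "weak_curl \<Omega> u \<in> Lp 2 \<Omega>" "has_weak_curl \<Omega> u (weak_curl \<Omega> u)"
    by (auto simp: weak_curl_def)
qed

text \<open>
  Each of the six products in \<open>u \<cdot> curl \<psi>\<close> is integrated by parts; the two sign changes, from the
  integration and from the antisymmetry of the curl, cancel.
\<close>
lemma classical_curl_symmetric:
  assumes \<Omega>: "open \<Omega>" and u: "u \<in> test_functions \<Omega>" and \<psi>: "\<psi> \<in> test_functions \<Omega>"
  shows "L2_inner \<Omega> u (classical_curl \<psi>) = L2_inner \<Omega> (classical_curl u) \<psi>"
proof -
  let ?M = "lebesgue_on \<Omega>"
  define a where "a i = (\<lambda>x. u x $ i)" for i
  define b where "b i = (\<lambda>x. cnj (\<psi> x $ i))" for i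
  have a: "a i \<in> test_functions \<Omega>" for i
    unfolding a_def by (rule test_functions_component[OF u])
  have b: "b i \<in> test_functions \<Omega>" for i
    unfolding b_def by (rule test_functions_linear[OF bounded_linear_cnj test_functions_component[OF \<psi>]])
  have u': "partial_deriv j u x $ i = partial_deriv j (a i) x" for i j x
    unfolding a_def by (rule partial_deriv_component[OF u])
  have \<psi>': "cnj (partial_deriv j \<psi> x $ i) = partial_deriv j (b i) x" for i j x
    unfolding b_def partial_deriv_component[OF \<psi>]
    by (rule partial_deriv_linear[OF bounded_linear_cnj
        test_functions_differentiable[OF test_functions_component[OF \<psi>]], symmetric])
  have i1: "integrable ?M (\<lambda>x. a i x * partial_deriv k (b j) x)" for i j k
    by (intro integrable_test_mult \<Omega> a b test_functions_partial_deriv)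
  have i2: "integrable ?M (\<lambda>x. partial_deriv k (a i) x * b j x)" for i j k
    by (intro integrable_test_mult \<Omega> a b test_functions_partial_deriv)
  have "L2_inner \<Omega> u (classical_curl \<psi>) = integral\<^sup>L ?M (\<lambda>x.
      a 1 x * partial_deriv 2 (b 3) x - a 1 x * partial_deriv 3 (b 2) x
      + (a 2 x * partial_deriv 3 (b 1) x - a 2 x * partial_deriv 1 (b 3) x)
      + (a 3 x * partial_deriv 1 (b 2) x - a 3 x * partial_deriv 2 (b 1) x))"
    unfolding L2_inner_def sum_3 classical_curl_component complex_cnj_diff \<psi>' right_diff_distrib a_def ..
  also have "\<dots> = integral\<^sup>L ?M (\<lambda>x.
      partial_deriv 2 (a 3) x * b 1 x - partial_deriv 3 (a 2) x * b 1 x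
      + (partial_deriv 3 (a 1) x * b 2 x - partial_deriv 1 (a 3) x * b 2 x)
      + (partial_deriv 1 (a 2) x * b 3 x - partial_deriv 2 (a 1) x * b 3 x))"
    by (simp add: i1 i2 integration_by_parts[OF \<Omega> a b])
  also have "\<dots> = L2_inner \<Omega> (classical_curl u) \<psi>"
    unfolding L2_inner_def sum_3 classical_curl_component u' left_diff_distrib b_def ..
  finally show ?thesis .
qed

lemma test_weak_curl:
  assumes \<Omega>: "open \<Omega>" and u: "u \<in> test_functions \<Omega>"
  shows "u \<in> H_curl \<Omega>" "AE x in lebesgue_on \<Omega>. weak_curl \<Omega> u x = classical_curl u x"
proof -
  have *: "classical_curl u \<in> Lp 2 \<Omega>" "has_weak_curl \<Omega> u (classical_curl u)"
    using test_functions_Lp[OF \<Omega> test_functions_classical_curl[OF u]] classical_curl_symmetric[OF \<Omega> u]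
    by (auto simp: has_weak_curl_def)
  then show "u \<in> H_curl \<Omega>" using test_functions_Lp[OF \<Omega> u] by (auto simp: H_curl_def)
  then show "AE x in lebesgue_on \<Omega>. weak_curl \<Omega> u x = classical_curl u x"
    using weak_curl_AE_unique[OF \<Omega>] weak_curl_spec * by blast
qed

text \<open>
  The weak curl is a choice among almost everywhere equal fields; for the zero field it is determined by
  uniqueness, and only up to a null set.
\<close>
lemma H_curl_norm_zero: 
  assumes \<Omega>: "open \<Omega>"
  shows "H_curl_norm \<Omega> (\<lambda>x. 0) = 0"
proof -
  have 0: "(\<lambda>x. 0) \<in> Lp 2 \<Omega>" "has_weak_curl \<Omega> (\<lambda>x. 0) (\<lambda>x. 0)"
    by (simp_all add: Lp_def has_weak_curl_def L2_inner_def)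
  then have H: "(\<lambda>x. 0) \<in> H_curl \<Omega>" by (auto simp: H_curl_def)
  have "L2_norm \<Omega> (weak_curl \<Omega> (\<lambda>x. 0)) = L2_norm \<Omega> (\<lambda>x. 0 :: complex^3)"
    by (rule L2_cong_AE(2)[OF weak_curl_spec(1)[OF H] 0(1) 0(1)
        weak_curl_AE_unique[OF \<Omega> weak_curl_spec[OF H] 0]])
  then show ?thesis by (simp add: H_curl_norm_def L2_norm_def)
qed

lemma test_H0_curl:
  assumes \<Omega>: "open \<Omega>" and u: "u \<in> test_functions \<Omega>"
  shows "u \<in> H0_curl \<Omega>"
  unfolding H0_curl_def using test_weak_curl(1)[OF \<Omega> u] u H_curl_norm_zero[OF \<Omega>] 
  by (auto intro!: bexI[of _ u])

text \<open>
  Elements of \<open>Lp p\<close> are integrable against test functions since \<open>|\<xi>| \<le> 1 + |\<xi>|\<^sup>p\<close>. It is needed for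
  \<open>p = 6\<close>, the integrability of the potentials in \<open>dot_H1_0\<close>.
\<close>
lemma Lp_test_mult_integrable:
  fixes \<xi> \<phi> :: scalar_field
  assumes \<Omega>: "open \<Omega>" and \<xi>: "\<xi> \<in> Lp p \<Omega>" and p: "p > 0" and \<phi>: "\<phi> \<in> test_functions \<Omega>"
  shows "integrable (lebesgue_on \<Omega>) (\<lambda>x. \<xi> x * \<phi> x)"
proof -
  obtain M where M: "\<And>x. norm (\<phi> x) \<le> M" using test_functions_bounded[OF \<phi>] by blast
  have "0 \<le> M" using M[of 0] norm_ge_zero order_trans by blast
  have \<phi>1: "integrable (lebesgue_on \<Omega>) (\<lambda>x. norm (\<phi> x))"
    using Lp_integrable[OF test_functions_Lp[OF \<Omega> \<phi>, of 1]] by simp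
  show ?thesis
  proof (rule Bochner_Integration.integrable_bound)
    show "integrable (lebesgue_on \<Omega>) (\<lambda>x. norm (\<phi> x) + M * norm (\<xi> x) ^ p)"
      by (intro Bochner_Integration.integrable_add integrable_mult_right \<phi>1 Lp_integrable[OF \<xi>])
    show "(\<lambda>x. \<xi> x * \<phi> x) \<in> borel_measurable (lebesgue_on \<Omega>)"
      by (intro borel_measurable_times Lp_measurable[OF \<xi>]
          continuous_measurable_lebesgue_on[OF test_functions_continuous[OF \<phi>]])
    show "AE x in lebesgue_on \<Omega>. norm (\<xi> x * \<phi> x) \<le> norm (norm (\<phi> x) + M * norm (\<xi> x) ^ p)"
    proof (rule AE_I2)
      fix x
      have "norm (\<xi> x) * norm (\<phi> x) \<le> norm (\<phi> x) + M * norm (\<xi> x) ^ p"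
      proof (cases "norm (\<xi> x) \<le> 1")
        case True
        have "norm (\<xi> x) * norm (\<phi> x) \<le> norm (\<phi> x)"
          using mult_right_mono[OF True norm_ge_zero[of "\<phi> x"]] by simp
        then show ?thesis using \<open>0 \<le> M\<close> by (simp add: add_increasing2)
      next
        case False
        then have "norm (\<xi> x) \<le> norm (\<xi> x) ^ p" using p by (intro self_le_power) auto
        then have "norm (\<xi> x) * norm (\<phi> x) \<le> norm (\<xi> x) ^ p * M"
          by (intro mult_mono M) auto
        then show ?thesis by (simp add: mult.commute add_increasing)
      qed
      then show "norm (\<xi> x * \<phi> x) \<le> norm (norm (\<phi> x) + M * norm (\<xi> x) ^ p)"
        by (simp add: norm_mult)
    qed
  qed
qed

text \<open>
  The weak gradient of \<open>\<xi>\<close> is tested with the components of the complex conjugate of \<open>u\<close>; after summation this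
  pairs \<open>\<xi>\<close> with the divergence of \<open>u\<close>.
\<close>
lemma test_H_div0:
  assumes \<Omega>: "open \<Omega>" and u: "u \<in> test_functions \<Omega>"
    and div: "\<And>x. (\<Sum>i\<in>UNIV. partial_deriv i u x $ i) = 0"
  shows "u \<in> H_div0 \<Omega>"
proof -
  let ?M = "lebesgue_on \<Omega>"
  have uL: "u \<in> Lp 2 \<Omega>" by (rule test_functions_Lp[OF \<Omega> u]) simp
  have "L2_inner \<Omega> u (weak_grad \<Omega> \<xi>) = 0" if \<xi>: "\<xi> \<in> dot_H1_0 \<Omega>" for \<xi>
  proof -
    define g where "g = weak_grad \<Omega> \<xi>"
    have "\<exists>g. g \<in> Lp 2 \<Omega> \<and> has_weak_grad \<Omega> \<xi> g" and \<xi>6: "\<xi> \<in> Lp 6 \<Omega>"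
      using \<xi> by (auto simp: dot_H1_0_def)
    from someI_ex[OF this(1)] have g: "g \<in> Lp 2 \<Omega>" "has_weak_grad \<Omega> \<xi> g"
      by (auto simp: g_def weak_grad_def)
    define b where "b i = (\<lambda>x. cnj (u x $ i))" for i
    have b: "b i \<in> test_functions \<Omega>" for i
      unfolding b_def by (rule test_functions_linear[OF bounded_linear_cnj test_functions_component[OF u]])
    have b': "partial_deriv j (b i) x = cnj (partial_deriv j u x $ i)" for i j x
      unfolding b_def partial_deriv_component[OF u]
      by (rule partial_deriv_linear[OF bounded_linear_cnj
          test_functions_differentiable[OF test_functions_component[OF u]]])
    have "cnj (L2_inner \<Omega> u g) = L2_inner \<Omega> g u" by (rule L2_inner_commute[symmetric])
    also have "\<dots> = (\<Sum>i\<in>UNIV. integral\<^sup>L ?M (\<lambda>x. g x $ i * b i x))"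
      unfolding b_def by (rule L2_inner_eq_sum[OF g(1) uL])
    also have "\<dots> = (\<Sum>i\<in>UNIV. - integral\<^sup>L ?M (\<lambda>x. \<xi> x * partial_deriv i (b i) x))"
      using g(2) b unfolding has_weak_grad_def by simp
    also have "\<dots> = - integral\<^sup>L ?M (\<lambda>x. \<Sum>i\<in>UNIV. \<xi> x * partial_deriv i (b i) x)"
      by (subst Bochner_Integration.integral_sum)
        (auto simp: sum_negf intro!: Lp_test_mult_integrable[OF \<Omega> \<xi>6] test_functions_partial_deriv b)
    also have "(\<lambda>x. \<Sum>i\<in>UNIV. \<xi> x * partial_deriv i (b i) x) = (\<lambda>x. 0)"
      by (simp only: b' sum_distrib_left[symmetric] cnj_sum[symmetric] div) simp
    finally show ?thesis by (simp add: g_def)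
  qed
  then show ?thesis using uL by (simp add: H_div0_def)
qed

text \<open>
  For a test field the boundary is invisible, and the operator acts as the classical double curl:
  \<open>(curl u, curl v) = (curl curl u, v)\<close> is the definition of the weak curl of \<open>v\<close>, applied to the test field
  \<open>curl u\<close>.
\<close>
lemma maxwell_operator_test:
  assumes \<Omega>: "open \<Omega>" and u: "u \<in> test_functions \<Omega>"
    and div: "\<And>x. (\<Sum>i\<in>UNIV. partial_deriv i u x $ i) = 0"
      "\<And>x. (\<Sum>i\<in>UNIV. partial_deriv i (classical_curl (classical_curl u)) x $ i) = 0"
  shows "(u, classical_curl (classical_curl u)) \<in> maxwell_operator \<Omega>"
proof -
  let ?c = "classical_curl u"
  have c: "?c \<in> test_functions \<Omega>" "classical_curl ?c \<in> test_functions \<Omega>"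
    by (intro test_functions_classical_curl u)+
  have "L2_inner \<Omega> (weak_curl \<Omega> u) (weak_curl \<Omega> v) = L2_inner \<Omega> (classical_curl ?c) v"
    if "v \<in> X_N0 \<Omega>" for v
  proof -
    have "v \<in> H_curl \<Omega>" using that by (simp add: X_N0_def H0_curl_def)
    note w = weak_curl_spec[OF this]
    have "L2_inner \<Omega> (weak_curl \<Omega> u) (weak_curl \<Omega> v) = L2_inner \<Omega> ?c (weak_curl \<Omega> v)"
      by (rule L2_cong_AE(1)[OF weak_curl_spec(1)[OF test_weak_curl(1)[OF \<Omega> u]]
          test_functions_Lp[OF \<Omega> c(1)] w(1) test_weak_curl(2)[OF \<Omega> u]]) simp
    also have "\<dots> = cnj (L2_inner \<Omega> (weak_curl \<Omega> v) ?c)" by (rule L2_inner_commute)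
    also have "L2_inner \<Omega> (weak_curl \<Omega> v) ?c = L2_inner \<Omega> v (classical_curl ?c)"
      using w(2) c(1) by (simp add: has_weak_curl_def)
    also have "cnj \<dots> = L2_inner \<Omega> (classical_curl ?c) v" by (rule L2_inner_commute[symmetric])
    finally show ?thesis .
  qed
  moreover have "u \<in> X_N0 \<Omega>"
    using test_H0_curl[OF \<Omega> u] test_H_div0[OF \<Omega> u div(1)] by (simp add: X_N0_def)
  moreover have "classical_curl ?c \<in> H_div0 \<Omega>"
    by (rule test_H_div0[OF \<Omega> c(2) div(2)])
  ultimately show ?thesis by (simp add: maxwell_operator_def form_operator_def)
qed

section \<open>Singular sequences\<close>

text \<open>
  The form is nonnegative: pairing \<open>f\<^sub>n - z x\<^sub>n\<close> with \<open>x\<^sub>n\<close> shows that the numbers \<open>\<parallel>curl x\<^sub>n\<parallel>\<^sup>2\<close> converge to \<open>z\<close>.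
\<close>
lemma essential_spectrum_maxwell_nonneg:
  assumes \<Omega>: "open \<Omega>" and z: "z \<in> essential_spectrum \<Omega> (H_div0 \<Omega>) (maxwell_operator \<Omega>)"
  shows "z \<in> complex_of_real ` {0..}"
proof -
  obtain x f where xf: "\<And>n. (x n, f n) \<in> maxwell_operator \<Omega>" "\<And>n. L2_norm \<Omega> (x n) = 1"
    and lim: "(\<lambda>n. L2_norm \<Omega> (\<lambda>y. f n y - z *s x n y)) \<longlonglongrightarrow> 0"
    using z by (auto simp: essential_spectrum_def)
  define c where "c n = (L2_norm \<Omega> (weak_curl \<Omega> (x n)))\<^sup>2" for n
  have bound: "norm (complex_of_real (c n) - z) \<le> L2_norm \<Omega> (\<lambda>y. f n y - z *s x n y)" for n
  proof -
    have x: "x n \<in> X_N0 \<Omega>" and f: "f n \<in> H_div0 \<Omega>"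
      and eq: "L2_inner \<Omega> (weak_curl \<Omega> (x n)) (weak_curl \<Omega> (x n)) = L2_inner \<Omega> (f n) (x n)"
      using xf(1)[of n] by (auto simp: maxwell_operator_def form_operator_def)
    have xL: "x n \<in> Lp 2 \<Omega>" and fL: "f n \<in> Lp 2 \<Omega>"
      using x f by (auto simp: X_N0_def H_div0_def)
    have "complex_of_real (c n) - z = L2_inner \<Omega> (f n) (x n) - z * L2_inner \<Omega> (x n) (x n)"
      unfolding eq[symmetric] L2_inner_self xf(2) by (simp add: c_def)
    also have "\<dots> = L2_inner \<Omega> (\<lambda>y. f n y - z *s x n y) (x n)"
      by (simp add: L2_inner_diff_left[OF fL Lp_2_scale[OF xL] xL] L2_inner_scale_left)
    finally show ?thesis
      using L2_inner_le[OF Lp_2_diff[OF fL Lp_2_scale[OF xL]] xL \<Omega>] xf(2) by simp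
  qed
  have "(\<lambda>n. complex_of_real (c n) - z) \<longlonglongrightarrow> 0"
    by (rule Lim_null_comparison[OF _ lim]) (use bound in simp)
  then have lim_c: "(\<lambda>n. complex_of_real (c n)) \<longlonglongrightarrow> z" by (simp add: LIM_zero_cancel)
  have mem: "complex_of_real (c n) \<in> complex_of_real ` {0..}" for n
    by (rule imageI) (simp add: c_def)
  have "closed (complex_of_real ` {0..})"
    by (intro closed_injective_linear_image[OF closed_atLeast] bounded_linear.linear[OF bounded_linear_of_real] inj_of_real)
  then show ?thesis by (rule closed_sequentially[OF _ mem lim_c])
qed

text \<open>
  Only the part of \<open>v\<close> over \<open>B n\<close> contributes, and its norm tends to 0 by dominated convergence: a
  given point belongs to at most one of the sets \<open>B n\<close>.
\<close>
lemma disjoint_supports_weakly_null: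
  assumes \<Omega>: "open \<Omega>" and x: "\<And>n. x n \<in> Lp 2 \<Omega>" "\<And>n. L2_norm \<Omega> (x n) = 1"
    and B: "disjoint_family B" "\<And>n. B n \<in> sets lebesgue" "\<And>n y. y \<notin> B n \<Longrightarrow> x n y = 0"
    and v: "v \<in> Lp 2 \<Omega>"
  shows "(\<lambda>n. L2_inner \<Omega> (x n) v) \<longlonglongrightarrow> 0"
proof -
  let ?I = "\<lambda>n. integral\<^sup>L (lebesgue_on \<Omega>) (\<lambda>y. indicator (B n) y * (norm (v y))\<^sup>2)"
  have "?I \<longlonglongrightarrow> integral\<^sup>L (lebesgue_on \<Omega>) (\<lambda>y. 0)"
  proof (rule integral_dominated_convergence[where w="\<lambda>y. (norm (v y))\<^sup>2"])
    show "(\<lambda>y. indicator (B n) y * (norm (v y))\<^sup>2) \<in> borel_measurable (lebesgue_on \<Omega>)" for n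
      by (intro borel_measurable_times borel_measurable_integrable[OF Lp_integrable[OF v]]
          measurable_restrict_space1 borel_measurable_indicator B(2))
    show "integrable (lebesgue_on \<Omega>) (\<lambda>y. (norm (v y))\<^sup>2)" by (rule Lp_integrable[OF v])
    show "AE y in lebesgue_on \<Omega>. norm (indicator (B n) y * (norm (v y))\<^sup>2) \<le> (norm (v y))\<^sup>2" for n
      by (auto simp: indicator_def)
    have "(\<lambda>n. indicator (B n) y * (norm (v y))\<^sup>2) \<longlonglongrightarrow> 0" for y
    proof (cases "\<exists>m. y \<in> B m")
      case True
      then obtain m where "y \<in> B m" ..
      then have "y \<notin> B n" if "n > m" for n
        using disjoint_family_onD[OF B(1), of m n] \<open>y \<in> B m\<close> that by blast
      then have "\<forall>\<^sub>F n in sequentially. indicator (B n) y * (norm (v y))\<^sup>2 = 0"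
        unfolding eventually_sequentially by (intro exI[of _ "Suc m"]) auto
      then show ?thesis by (rule tendsto_eventually)
    qed simp
    then show "AE y in lebesgue_on \<Omega>. (\<lambda>n. indicator (B n) y * (norm (v y))\<^sup>2) \<longlonglongrightarrow> 0" by simp
  qed simp
  then have "(\<lambda>n. sqrt (?I n)) \<longlonglongrightarrow> 0"
    using tendsto_real_sqrt[of ?I 0] by simp
  then show ?thesis
  proof (rule Lim_null_comparison[rotated], intro always_eventually allI)
    show "norm (L2_inner \<Omega> (x n) v) \<le> sqrt (?I n)" for n
      using L2_inner_le_set[OF x(1) v B(2) \<Omega> B(3), of n] x(2) by simp
  qed
qed

section \<open>Divergence-free wave packets\<close>

lemma cis_has_vector_derivative:
  "((\<lambda>t. cis (w * t)) has_vector_derivative (\<i> * w * cis (w * t))) (at t)"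
proof -
  have "((\<lambda>t. cis (w * t)) has_derivative (\<lambda>h. (h * w) *\<^sub>R (\<i> * cis (w * t)))) (at t)"
    by (auto intro!: derivative_eq_intros simp: algebra_simps)
  then show ?thesis
    by (auto simp: has_vector_derivative_def algebra_simps scaleR_conv_of_real)
qed

text \<open>
  The curl of \<open>(0, 0, q)\<close> for \<open>q = F a \<otimes> G b \<otimes> H c\<close>, that is, \<open>(\<partial>\<^sub>2q, -\<partial>\<^sub>1q, 0)\<close>.
\<close>
definition swirl :: "(nat \<Rightarrow> real \<Rightarrow> complex) \<Rightarrow> (nat \<Rightarrow> real \<Rightarrow> complex) \<Rightarrow> (nat \<Rightarrow> real \<Rightarrow> complex) \<Rightarrow>
    nat \<Rightarrow> nat \<Rightarrow> nat \<Rightarrow> vector_field" where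
  "swirl F G H a b c x =
     vector [tensor (F a) (G (Suc b)) (H c) x, - tensor (F (Suc a)) (G b) (H c) x, 0]"

lemma swirl_component:
  "swirl F G H a b c x $ 1 = tensor (F a) (G (Suc b)) (H c) x"
  "swirl F G H a b c x $ 2 = - tensor (F (Suc a)) (G b) (H c) x"
  "swirl F G H a b c x $ 3 = 0"
  by (simp_all add: swirl_def)

lemma test_functions_minus: "f \<in> test_functions \<Omega> \<Longrightarrow> (\<lambda>x. - f x) \<in> test_functions \<Omega>"
  by (rule test_functions_linear[OF bounded_linear_minus[OF bounded_linear_ident]])

lemma test_functions_zero: "(\<lambda>x. 0) \<in> test_functions \<Omega>"
  by (rule test_functionsI[of _ "{}"]) (auto intro: C_k_zero)

lemma partial_deriv_minus:
  "f differentiable (at x) \<Longrightarrow> partial_deriv i (\<lambda>x. - f x) x = - partial_deriv i f x"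
  by (rule partial_deriv_linear[OF bounded_linear_minus[OF bounded_linear_ident]])

lemma partial_deriv_zero: "partial_deriv i (\<lambda>x. 0) x = 0"
  by (rule partial_deriv_zero_off_closed[of "{}"]) auto

context
  fixes F G H :: "nat \<Rightarrow> real \<Rightarrow> complex" and l u :: "real^3" and \<Omega> :: "(real^3) set"
  assumes chains: "derivative_chain F" "derivative_chain G" "derivative_chain H"
    and box: "cbox l u \<subseteq> \<Omega>"
    and support: "\<And>t. t \<notin> {l $ 1..u $ 1} \<Longrightarrow> F 0 t = 0" "\<And>t. t \<notin> {l $ 2..u $ 2} \<Longrightarrow> G 0 t = 0"
      "\<And>t. t \<notin> {l $ 3..u $ 3} \<Longrightarrow> H 0 t = 0"
begin

lemma chain_support:
  "t \<notin> {l $ 1..u $ 1} \<Longrightarrow> F n t = 0" "t \<notin> {l $ 2..u $ 2} \<Longrightarrow> G n t = 0"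
  "t \<notin> {l $ 3..u $ 3} \<Longrightarrow> H n t = 0"
  using derivative_chain_zero_outside[OF chains(1) closed_atLeastAtMost, of "l $ 1" "u $ 1"]
    derivative_chain_zero_outside[OF chains(2) closed_atLeastAtMost, of "l $ 2" "u $ 2"]
    derivative_chain_zero_outside[OF chains(3) closed_atLeastAtMost, of "l $ 3" "u $ 3"] support
  by blast+

lemma tensor_chain_test: "tensor (F a) (G b) (H c) \<in> test_functions \<Omega>"
  by (rule test_functions_tensor[OF chains box]) (rule chain_support, assumption)+

lemma tensor_chain_zero:
  assumes "x \<notin> cbox l u"
  shows "tensor (F a) (G b) (H c) x = 0"
proof -
  consider "x $ 1 \<notin> {l $ 1..u $ 1}" | "x $ 2 \<notin> {l $ 2..u $ 2}" | "x $ 3 \<notin> {l $ 3..u $ 3}"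
    using assms by (auto simp: mem_box_cart forall_3)
  then have "F a (x $ 1) = 0 \<or> G b (x $ 2) = 0 \<or> H c (x $ 3) = 0"
    using chain_support by cases blast+
  then show ?thesis by (auto simp: tensor_def)
qed

lemma swirl_zero: "x \<notin> cbox l u \<Longrightarrow> swirl F G H a b c x = 0"
  by (simp add: vec_eq_iff forall_3 swirl_component tensor_chain_zero)

lemma swirl_test: "swirl F G H a b c \<in> test_functions \<Omega>"
proof (rule test_functions_componentwise)
  have "\<forall>i. (\<lambda>x. swirl F G H a b c x $ i) \<in> test_functions \<Omega>"
    unfolding forall_3 swirl_component
    by (intro conjI tensor_chain_test test_functions_minus test_functions_zero)
  then show "(\<lambda>x. swirl F G H a b c x $ i) \<in> test_functions \<Omega>" for i by blast
qed

lemma partial_deriv_swirl: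
  "partial_deriv 1 (swirl F G H a b c) = swirl F G H (Suc a) b c"
  "partial_deriv 2 (swirl F G H a b c) = swirl F G H a (Suc b) c"
  "partial_deriv 3 (swirl F G H a b c) = swirl F G H a b (Suc c)"
  by (simp_all add: fun_eq_iff vec_eq_iff forall_3 partial_deriv_component[OF swirl_test] swirl_component
      partial_deriv_minus tensor_differentiable[OF chains] partial_deriv_tensor[OF chains] partial_deriv_zero)

lemma div_swirl: "(\<Sum>i\<in>UNIV. partial_deriv i (swirl F G H a b c) x $ i) = 0"
  by (simp add: sum_3 partial_deriv_swirl swirl_component)

text \<open>
  On divergence-free fields the double curl is the negative Laplacian, and the Laplacian raises one of the
  three indices by two.
\<close>
lemma curl_curl_swirl:
  "classical_curl (classical_curl (swirl F G H 0 0 0)) =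
    (\<lambda>x. - (swirl F G H 2 0 0 x + swirl F G H 0 2 0 x + swirl F G H 0 0 2 x))"
proof -
  let ?T = "\<lambda>a b c. tensor (F a) (G b) (H c)" and ?c = "classical_curl (swirl F G H 0 0 0)"
  have c: "?c \<in> test_functions \<Omega>"
    by (rule test_functions_classical_curl[OF swirl_test])
  have "(\<lambda>x. ?c x $ 1) = ?T 1 0 1" "(\<lambda>x. ?c x $ 2) = ?T 0 1 1"
    "(\<lambda>x. ?c x $ 3) = (\<lambda>x. - (?T 2 0 0 x + ?T 0 2 0 x))"
    by (simp_all add: fun_eq_iff classical_curl_component partial_deriv_swirl swirl_component numeral_2_eq_2)
  then have "partial_deriv j ?c x $ 1 = partial_deriv j (?T 1 0 1) x"
    "partial_deriv j ?c x $ 2 = partial_deriv j (?T 0 1 1) x"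
    "partial_deriv j ?c x $ 3 = - (partial_deriv j (?T 2 0 0) x + partial_deriv j (?T 0 2 0) x)" for j x
    by (simp_all only: partial_deriv_component[OF c] partial_deriv_minus partial_deriv_add
        tensor_differentiable[OF chains] differentiable_add)
  then show ?thesis
    by (simp add: fun_eq_iff vec_eq_iff forall_3 classical_curl_component[of ?c] swirl_component
        partial_deriv_tensor[OF chains] numeral_2_eq_2)
qed

lemma maxwell_operator_swirl:
  assumes \<Omega>: "open \<Omega>"
  shows "(swirl F G H 0 0 0, \<lambda>x. - (swirl F G H 2 0 0 x + swirl F G H 0 2 0 x + swirl F G H 0 0 2 x))
    \<in> maxwell_operator \<Omega>"
  unfolding curl_curl_swirl[symmetric]
proof (rule maxwell_operator_test[OF \<Omega> swirl_test div_swirl])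
  note d = test_functions_differentiable[OF swirl_test]
  show "(\<Sum>i\<in>UNIV. partial_deriv i (classical_curl (classical_curl (swirl F G H 0 0 0))) x $ i) = 0" for x
    unfolding curl_curl_swirl partial_deriv_minus[OF differentiable_add[OF differentiable_add[OF d d] d]]
      partial_deriv_add[OF differentiable_add[OF d d] d] partial_deriv_add[OF d d]
    by (simp add: sum.distrib sum_subtractf sum_negf div_swirl)
qed

end

lemma derivative_chain_affine:
  assumes "derivative_chain B"
  shows "derivative_chain (\<lambda>n t. complex_of_real (s ^ n) * B n (s * t + q))"
  unfolding derivative_chain_def
proof (intro allI)
  fix n t
  have "((\<lambda>t. B n (s * t + q)) has_vector_derivative s *\<^sub>R B (Suc n) (s * t + q)) (at t)"
    using assms unfolding derivative_chain_def by (intro affine_has_vector_derivative) auto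
  from has_vector_derivative_mult_right[OF this, of "complex_of_real (s ^ n)"]
  show "((\<lambda>t. complex_of_real (s ^ n) * B n (s * t + q)) has_vector_derivative
      complex_of_real (s ^ Suc n) * B (Suc n) (s * t + q)) (at t)"
    by (simp add: scaleR_conv_of_real mult_ac)
qed

lemma derivative_chain_scale:
  assumes "derivative_chain B"
  shows "derivative_chain (\<lambda>n t. \<kappa> * B n t)"
  using assms by (simp add: derivative_chain_def has_vector_derivative_mult_right)

text \<open>
  The derivative of \<open>e\<^sup>i\<^sup>w\<^sup>t g(t)\<close> is \<open>e\<^sup>i\<^sup>w\<^sup>t (i w g + g')(t)\<close>; this is the resulting operation on derivative chains.
\<close>
definition twist :: "real \<Rightarrow> (nat \<Rightarrow> real \<Rightarrow> complex) \<Rightarrow> nat \<Rightarrow> real \<Rightarrow> complex" where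
  "twist w G j t = \<i> * w * G j t + G (Suc j) t"

text \<open>
  The derivatives of \<open>e\<^sup>i\<^sup>w\<^sup>t G 0 t\<close>.
\<close>
definition modulate :: "real \<Rightarrow> (nat \<Rightarrow> real \<Rightarrow> complex) \<Rightarrow> nat \<Rightarrow> real \<Rightarrow> complex" where
  "modulate w G n t = cis (w * t) * (twist w ^^ n) G 0 t"

lemma derivative_chain_twist:
  assumes "derivative_chain G"
  shows "derivative_chain (twist w G)"
  using assms unfolding derivative_chain_def twist_def
  by (intro allI has_vector_derivative_add has_vector_derivative_mult_right) auto

lemma derivative_chain_modulate:
  assumes "derivative_chain G"
  shows "derivative_chain (modulate w G)"
proof -
  have *: "derivative_chain ((twist w ^^ n) G)" for n
    by (induction n) (simp_all add: assms derivative_chain_twist)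
  show ?thesis unfolding derivative_chain_def
  proof (intro allI)
    fix n t
    let ?g = "(twist w ^^ n) G"
    have "(?g 0 has_vector_derivative ?g (Suc 0) t) (at t)"
      using *[of n] by (simp add: derivative_chain_def)
    from has_vector_derivative_mult[OF cis_has_vector_derivative[of w] this]
    show "(modulate w G n has_vector_derivative modulate w G (Suc n) t) (at t)"
      unfolding modulate_def[abs_def] by (simp add: twist_def algebra_simps)
  qed
qed

text \<open>
  Second and third derivatives are split into the part that a pure wave would produce, \<open>-w\<^sup>2\<close> times
  the function two orders lower, and a remainder in which at least one derivative falls on the
  envelope.
\<close>
lemma modulate_simps:
  "modulate w G 0 t = cis (w * t) * G 0 t"
  "modulate w G (Suc 0) t = cis (w * t) * (\<i> * w * G 0 t + G 1 t)"
  "modulate w G 2 t = cis (w * t) * (2 * \<i> * w * G 1 t + G 2 t) - complex_of_real (w\<^sup>2) * modulate w G 0 t"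
  "modulate w G 3 t = cis (w * t) * (- 2 * complex_of_real (w\<^sup>2) * G 1 t + 3 * \<i> * w * G 2 t + G 3 t)
      - complex_of_real (w\<^sup>2) * modulate w G (Suc 0) t"
  by (simp_all add: modulate_def twist_def numeral_2_eq_2 numeral_3_eq_3 algebra_simps power2_eq_square)

section \<open>Norm estimates\<close>

definition cube :: "real^3 \<Rightarrow> real \<Rightarrow> (real^3) set" where
  "cube c r = cbox (c - (\<chi> i. r)) (c + (\<chi> i. r))"

lemma measure_cube:
  assumes "0 \<le> r"
  shows "measure lborel (cube c r) = (2 * r) ^ 3"
proof -
  have "measure lborel (cube c r) = (\<Prod>i\<in>(UNIV :: 3 set). 2 * r)"
    unfolding cube_def using assms by (subst content_cbox_cart) (auto simp: interval_ne_empty_cart)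
  then show ?thesis by simp
qed

lemma mem_cube: "x \<in> cube c r \<longleftrightarrow> (\<forall>i. \<bar>x $ i - c $ i\<bar> \<le> r)"
  unfolding cube_def mem_box_cart by (auto simp: abs_le_iff algebra_simps)

lemma cube_mono: "r \<le> r' \<Longrightarrow> cube c r \<subseteq> cube c r'"
  unfolding mem_cube subset_iff using order_trans by blast

lemma cube_indicator:
  assumes "open \<Omega>" "cube c r \<subseteq> \<Omega>"
  shows "integrable (lebesgue_on \<Omega>) (indicator (cube c r) :: real^3 \<Rightarrow> real)"
    and "integral\<^sup>L (lebesgue_on \<Omega>) (indicator (cube c r) :: real^3 \<Rightarrow> real) = measure lborel (cube c r)"
proof -
  have b: "cube c r \<in> sets borel" "emeasure lborel (cube c r) < \<infinity>"
    unfolding cube_def by (simp, rule emeasure_lborel_cbox_finite)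
  show "integrable (lebesgue_on \<Omega>) (indicator (cube c r) :: real^3 \<Rightarrow> real)"
    "integral\<^sup>L (lebesgue_on \<Omega>) (indicator (cube c r) :: real^3 \<Rightarrow> real) = measure lborel (cube c r)"
    by (rule indicator_lebesgue_on[OF assms(1) b assms(2)])+
qed

lemma L2_norm_le_on_cube:
  assumes \<Omega>: "open \<Omega>" "cube c r \<subseteq> \<Omega>" and e: "e \<in> Lp 2 \<Omega>" and K: "0 \<le> K" and r: "0 \<le> r"
    and bound: "\<And>x. x \<in> cube c r \<Longrightarrow> norm (e x) \<le> K" and off: "\<And>x. x \<notin> cube c r \<Longrightarrow> e x = 0"
  shows "L2_norm \<Omega> e \<le> K * sqrt ((2 * r) ^ 3)"
proof -
  have "integral\<^sup>L (lebesgue_on \<Omega>) (\<lambda>x. (norm (e x))\<^sup>2) \<le> integral\<^sup>L (lebesgue_on \<Omega>) (\<lambda>x. K\<^sup>2 * indicator (cube c r) x)"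
  proof (rule Bochner_Integration.integral_mono)
    show "(norm (e x))\<^sup>2 \<le> K\<^sup>2 * indicator (cube c r) x" for x
      using bound[of x] off[of x] by (cases "x \<in> cube c r") (auto intro: power_mono)
  qed (intro Lp_integrable[OF e] integrable_mult_right cube_indicator \<Omega>)+
  also have "\<dots> = K\<^sup>2 * (2 * r) ^ 3"
    using cube_indicator[OF \<Omega>] measure_cube[OF r, of c] by simp
  finally have "L2_norm \<Omega> e \<le> sqrt (K\<^sup>2 * (2 * r) ^ 3)"
    unfolding L2_norm_def by (rule real_sqrt_le_mono)
  also have "\<dots> = K * sqrt ((2 * r) ^ 3)" using K by (simp add: real_sqrt_mult)
  finally show ?thesis .
qed

lemma L2_norm_ge_on_cube:
  assumes \<Omega>: "open \<Omega>" "cube c r \<subseteq> \<Omega>" and e: "e \<in> Lp 2 \<Omega>" and k: "0 \<le> k" and r: "0 \<le> r"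
    and bound: "\<And>x. x \<in> cube c r \<Longrightarrow> k \<le> norm (e x)"
  shows "k * sqrt ((2 * r) ^ 3) \<le> L2_norm \<Omega> e"
proof -
  have "k * sqrt ((2 * r) ^ 3) = sqrt (k\<^sup>2 * (2 * r) ^ 3)" using k by (simp add: real_sqrt_mult)
  also have "k\<^sup>2 * (2 * r) ^ 3 = integral\<^sup>L (lebesgue_on \<Omega>) (\<lambda>x. k\<^sup>2 * indicator (cube c r) x)"
    using cube_indicator[OF \<Omega>] measure_cube[OF r, of c] by simp
  also have "\<dots> \<le> integral\<^sup>L (lebesgue_on \<Omega>) (\<lambda>x. (norm (e x))\<^sup>2)"
  proof (rule Bochner_Integration.integral_mono)
    show "k\<^sup>2 * indicator (cube c r) x \<le> (norm (e x))\<^sup>2" for x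
      using bound[of x] k by (cases "x \<in> cube c r") (auto intro: power_mono)
  qed (intro Lp_integrable[OF e] integrable_mult_right cube_indicator \<Omega>)+
  finally show ?thesis unfolding L2_norm_def by (simp add: real_sqrt_le_mono)
qed

lemma L2_norm_scale: "L2_norm \<Omega> (\<lambda>x. \<kappa> *s v x :: complex^3) = cmod \<kappa> * L2_norm \<Omega> v"
  unfolding L2_norm_def by (simp add: norm_vector_scale power_mult_distrib real_sqrt_mult)

text \<open>
  The constants \<open>m\<close> and \<open>M\<close> are those on which the final estimate depends. The first derivative being
  real matters for the lower bound of the wave: the modulus of \<open>i w b + b'\<close> is then at least
  \<open>w |b|\<close>.
\<close>
lemma bump_profile:
  obtains B m M where "derivative_chain B" "0 < m" "1 \<le> M" "\<And>t. t \<notin> {-1..1} \<Longrightarrow> B 0 t = 0"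
    "\<And>n t. n \<le> 3 \<Longrightarrow> cmod (B n t) \<le> M" "\<And>t. \<bar>t\<bar> \<le> 1/2 \<Longrightarrow> m \<le> Re (B 0 t)" "\<And>t. Im (B 1 t) = 0"
proof -
  obtain B where B: "derivative_chain B" "B 0 = (\<lambda>t. complex_of_real (bump (-1) 1 t))"
    using elementary_derivative_chain[OF elementary_bump] by metis
  have supp: "B 0 t = 0" if "t \<notin> {-1..1}" for t
    using that bump_eq_0_iff[of "-1" 1 t] by (auto simp: B(2))
  have "\<exists>M. \<forall>t. cmod (B n t) \<le> M" for n
    by (rule derivative_chain_bounded[OF B(1) compact_Icc supp])
  then obtain M where M: "\<And>n t. cmod (B n t) \<le> M n" by metis
  define M' where "M' = Max (insert 1 (M ` {..3}))"
  have "M n \<le> M'" if "n \<le> 3" for n unfolding M'_def using that by (intro Max_ge) auto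
  then have M': "cmod (B n t) \<le> M'" if "n \<le> 3" for n t using M[of n t] that by force
  have "1 \<le> M'" unfolding M'_def by (intro Max_ge) auto
  have low: "exp (-4) \<le> Re (B 0 t)" if t: "\<bar>t\<bar> \<le> 1/2" for t
  proof -
    have fl: "exp (-2) \<le> flat 1 s" if "1/2 \<le> s" for s :: real
    proof -
      have "inverse s \<le> 2" using le_imp_inverse_le[OF that] by simp
      then show ?thesis using that by (simp add: flat_def)
    qed
    have "exp (-4) = exp (-2) * exp (-2 :: real)" by (simp flip: exp_add)
    also have "\<dots> \<le> flat 1 (t - -1) * flat 1 (1 - t)"
      using t by (intro mult_mono fl flat_1_range) auto
    finally show ?thesis by (simp add: B(2) bump_def)
  qed
  have im: "Im (B 1 t) = 0" for t
  proof -
    have "(B 0 has_vector_derivative B 1 t) (at t)"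
      using B(1) by (simp add: derivative_chain_def)
    then have "((\<lambda>t. Im (B 0 t)) has_vector_derivative Im (B 1 t)) (at t)"
      by (rule bounded_linear.has_vector_derivative[OF bounded_linear_Im])
    then have "((\<lambda>t. 0) has_vector_derivative Im (B 1 t)) (at t)" by (simp add: B(2))
    then show ?thesis using vector_derivative_unique_at has_vector_derivative_const by blast
  qed
  show ?thesis using that[OF B(1) _ \<open>1 \<le> M'\<close> supp M' low im] by simp
qed

lemma norm_mult3_le:
  fixes a b c :: complex
  assumes "cmod a \<le> A" "cmod b \<le> B" "cmod c \<le> C"
  shows "cmod (a * b * c) \<le> A * B * C"
proof -
  have "0 \<le> A" "0 \<le> B" using assms norm_ge_zero order_trans by blast+
  then show ?thesis unfolding norm_mult using assms by (intro mult_mono) auto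
qed

lemma norm_add4_le: "norm (a + b + c + d) \<le> norm a + norm b + norm c + norm d"
  by (meson add_mono norm_triangle_ineq norm_triangle_mono order_refl)

text \<open>
  Here \<open>s\<close> is the inverse length scale of the envelope, whose \<open>n\<close>-th derivative is of size \<open>s\<^sup>n\<close>. Once
  the wave part is removed, the second and third derivatives of the modulated envelope are smaller
  by a factor \<open>s/w\<close> than \<open>w\<^sup>2\<close> and \<open>w\<^sup>3\<close>.
\<close>
lemma modulate_bounds:
  assumes G: "\<And>n. n \<le> 3 \<Longrightarrow> cmod (G n t) \<le> s ^ n * M" and s: "0 \<le> s" "s \<le> w" and M: "0 \<le> M"
  shows "cmod (modulate w G 0 t) \<le> M"
    and "cmod (modulate w G (Suc 0) t) \<le> 2 * w * M"
    and "cmod (modulate w G 2 t + complex_of_real (w\<^sup>2) * modulate w G 0 t) \<le> 3 * w * s * M"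
    and "cmod (modulate w G 3 t + complex_of_real (w\<^sup>2) * modulate w G (Suc 0) t) \<le> 6 * w\<^sup>2 * s * M"
proof -
  have w: "0 \<le> w" using s by linarith
  have G0: "cmod (G 0 t) \<le> M" and G1: "cmod (G (Suc 0) t) \<le> s * M"
    and G2: "cmod (G 2 t) \<le> s\<^sup>2 * M" and G3: "cmod (G 3 t) \<le> s ^ 3 * M"
    using G[of 0] G[of 1] G[of 2] G[of 3] by simp_all
  show "cmod (modulate w G 0 t) \<le> M" using G0 by (simp add: modulate_simps norm_mult)
  have sM: "s * M \<le> w * M" and ssM: "s\<^sup>2 * M \<le> w * s * M" and sssM: "s ^ 3 * M \<le> w\<^sup>2 * s * M"
    and wssM: "w * (s\<^sup>2 * M) \<le> w\<^sup>2 * s * M"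
    using s w M by (auto simp: power2_eq_square power3_eq_cube mult.assoc intro!: mult_mono)
  have "cmod (\<i> * w * G 0 t + G (Suc 0) t) \<le> w * M + s * M"
    using norm_triangle_ineq[of "\<i> * w * G 0 t" "G (Suc 0) t"] mult_left_mono[OF G0 w] G1 w
    by (simp add: norm_mult)
  then show "cmod (modulate w G (Suc 0) t) \<le> 2 * w * M"
    using sM by (simp add: modulate_simps norm_mult)
  have "cmod (2 * \<i> * w * G (Suc 0) t + G 2 t) \<le> 2 * w * (s * M) + s\<^sup>2 * M"
    using norm_triangle_ineq[of "2 * \<i> * w * G (Suc 0) t" "G 2 t"] mult_left_mono[OF G1 w] G2 w
    by (simp add: norm_mult)
  then show "cmod (modulate w G 2 t + complex_of_real (w\<^sup>2) * modulate w G 0 t) \<le> 3 * w * s * M"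
    using ssM by (simp add: modulate_simps norm_mult)
  have "cmod (- 2 * complex_of_real (w\<^sup>2) * G (Suc 0) t + 3 * \<i> * w * G 2 t + G 3 t)
      \<le> 2 * w\<^sup>2 * (s * M) + 3 * (w * (s\<^sup>2 * M)) + s ^ 3 * M"
    using norm_triangle_ineq[of "- 2 * complex_of_real (w\<^sup>2) * G (Suc 0) t + 3 * \<i> * w * G 2 t" "G 3 t"]
      norm_triangle_ineq[of "- 2 * complex_of_real (w\<^sup>2) * G (Suc 0) t" "3 * \<i> * w * G 2 t"]
      mult_left_mono[OF G1 zero_le_power2[of w]] mult_left_mono[OF G2 w] G3 w
    by (simp add: norm_mult norm_power)
  then show "cmod (modulate w G 3 t + complex_of_real (w\<^sup>2) * modulate w G (Suc 0) t) \<le> 6 * w\<^sup>2 * s * M"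
    using sssM wssM by (simp add: modulate_simps norm_mult)
qed

lemma norm_vec3_le: "norm (v :: complex^3) \<le> cmod (v $ 1) + cmod (v $ 2) + cmod (v $ 3)"
  unfolding norm_vec_def using L2_set_le_sum[of UNIV "\<lambda>i. norm (v $ i)"] by (simp add: sum_3)

text \<open>
  The expression is \<open>curl curl u - \<lambda>u\<close> for the wave packet \<open>u\<close>. After the wave parts have been
  collected in the coefficient \<open>w\<^sup>2 - \<lambda>\<close>, each term contains a factor \<open>s\<close> and two further factors \<open>s\<close> or \<open>w\<close>.
  The terms of the first component add up to at most 7, those of the second to at most 14 times the unit \<open>w\<^sup>2 s M\<^sup>3\<close>.
\<close>
lemma swirl_residual_bound:
  fixes lam :: real
  assumes G: "\<And>n t. n \<le> 3 \<Longrightarrow> cmod (P n t) \<le> s ^ n * M" "\<And>n t. n \<le> 3 \<Longrightarrow> cmod (G n t) \<le> s ^ n * M"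
      "\<And>n t. n \<le> 3 \<Longrightarrow> cmod (H n t) \<le> s ^ n * M"
    and s: "0 \<le> s" "s \<le> w" and M: "0 \<le> M" and lam: "\<bar>w\<^sup>2 - lam\<bar> \<le> 2 * w * s"
  defines "S \<equiv> swirl (modulate w P) G H"
  shows "norm (- (S 2 0 0 x + S 0 2 0 x + S 0 0 2 x) - complex_of_real lam *s S 0 0 0 x)
    \<le> 21 * (w\<^sup>2 * s * M ^ 3)"
proof -
  define F where "F = modulate w P"
  let ?T = "\<lambda>a b c. tensor (F a) (G b) (H c) x"
  let ?v = "- (S 2 0 0 x + S 0 2 0 x + S 0 0 2 x) - complex_of_real lam *s S 0 0 0 x"
  have w: "0 \<le> w" using s by linarith
  define X where "X = w\<^sup>2 * s * M ^ 3"
  have X1: "w * s * s * M ^ 3 \<le> X" and X2: "s * s * s * M ^ 3 \<le> X"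
    using s w M unfolding X_def by (auto simp: power2_eq_square intro!: mult_mono)
  note F = modulate_bounds[of P _ s M w, OF G(1) s M, folded F_def]
  have G': "cmod (G 0 t) \<le> M" "cmod (G 1 t) \<le> s * M" "cmod (G 2 t) \<le> s\<^sup>2 * M" "cmod (G 3 t) \<le> s ^ 3 * M" for t
    using G(2)[of 0 t] G(2)[of 1 t] G(2)[of 2 t] G(2)[of 3 t] by simp_all
  have H': "cmod (H 0 t) \<le> M" "cmod (H 2 t) \<le> s\<^sup>2 * M" for t
    using G(3)[of 0 t] G(3)[of 2 t] by simp_all
  have d: "cmod (complex_of_real (w\<^sup>2 - lam)) \<le> 2 * w * s" using lam by (simp only: norm_of_real)
  have d0: "cmod (complex_of_real (w\<^sup>2 - lam) * F 0 t) \<le> 2 * w * s * M" for t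
    unfolding norm_mult using d F(1)[of t] w s by (intro mult_mono) auto
  have d1: "cmod (complex_of_real (w\<^sup>2 - lam) * F (Suc 0) t) \<le> 2 * w * s * (2 * w * M)" for t
    unfolding norm_mult using d F(2)[of t] w s by (intro mult_mono) auto
  have 1: "?v $ 1 = - ((F 2 (x $ 1) + complex_of_real (w\<^sup>2) * F 0 (x $ 1)) * G 1 (x $ 2) * H 0 (x $ 3))
      + - (F 0 (x $ 1) * G 3 (x $ 2) * H 0 (x $ 3)) + - (F 0 (x $ 1) * G 1 (x $ 2) * H 2 (x $ 3))
      + (complex_of_real (w\<^sup>2 - lam) * F 0 (x $ 1)) * G 1 (x $ 2) * H 0 (x $ 3)"
    unfolding S_def F_def[symmetric]
    by (simp add: swirl_component tensor_def algebra_simps numeral_3_eq_3 numeral_2_eq_2)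
  have 2: "?v $ 2 = (F 3 (x $ 1) + complex_of_real (w\<^sup>2) * F (Suc 0) (x $ 1)) * G 0 (x $ 2) * H 0 (x $ 3)
      + F (Suc 0) (x $ 1) * G 2 (x $ 2) * H 0 (x $ 3) + F (Suc 0) (x $ 1) * G 0 (x $ 2) * H 2 (x $ 3)
      + - ((complex_of_real (w\<^sup>2 - lam) * F (Suc 0) (x $ 1)) * G 0 (x $ 2) * H 0 (x $ 3))"
    unfolding S_def F_def[symmetric]
    by (simp add: swirl_component tensor_def algebra_simps numeral_3_eq_3 numeral_2_eq_2)
  have "cmod (?v $ 1) \<le> 3 * w * s * M * (s * M) * M + M * (s ^ 3 * M) * M + M * (s * M) * (s\<^sup>2 * M)
      + 2 * w * s * M * (s * M) * M"
    unfolding 1 by (rule norm_add4_le[THEN order_trans], unfold norm_minus_cancel)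
      (intro add_mono norm_mult3_le F G' H' d0)
  also have "\<dots> = 5 * (w * s * s * M ^ 3) + 2 * (s * s * s * M ^ 3)"
    by (simp add: power2_eq_square power3_eq_cube algebra_simps)
  also have "\<dots> \<le> 7 * X" using X1 X2 by linarith
  finally have n1: "cmod (?v $ 1) \<le> 7 * X" .
  have "cmod (?v $ 2) \<le> 6 * w\<^sup>2 * s * M * M * M + 2 * w * M * (s\<^sup>2 * M) * M + 2 * w * M * M * (s\<^sup>2 * M)
      + 2 * w * s * (2 * w * M) * M * M"
    unfolding 2 by (rule norm_add4_le[THEN order_trans], unfold norm_minus_cancel)
      (intro add_mono norm_mult3_le F G' H' d1)
  also have "\<dots> = 10 * X + 4 * (w * s * s * M ^ 3)"
    by (simp add: X_def power2_eq_square power3_eq_cube algebra_simps)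
  also have "\<dots> \<le> 14 * X" using X1 by linarith
  finally have n2: "cmod (?v $ 2) \<le> 14 * X" .
  have "?v $ 3 = 0" unfolding S_def by (simp add: swirl_component)
  with n1 n2 norm_vec3_le[of ?v] show ?thesis by (simp add: X_def)
qed

text \<open>
  With \<open>s = 1/r\<close> and \<open>w = sqrt \<lambda> + s\<close> one has \<open>0 \<le> w\<^sup>2 - \<lambda> \<le> 2 w s\<close>, so the residual of the wave packet is at
  most \<open>21 w\<^sup>2 s M\<^sup>3\<close> on a cube of volume \<open>(2r)\<^sup>3\<close>. On the concentric cube of half the size the packet is at least
  \<open>w m\<^sup>3\<close>. The powers of \<open>r\<close> from the volumes cancel in the quotient, leaving \<open>w s\<close>.
\<close>
lemma maxwell_quasimode:
  obtains C where "\<And>\<Omega> lam c r. open \<Omega> \<Longrightarrow> 0 \<le> lam \<Longrightarrow> 0 < r \<Longrightarrow> cube c r \<subseteq> \<Omega> \<Longrightarrow>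
    \<exists>u f. (u, f) \<in> maxwell_operator \<Omega> \<and> L2_norm \<Omega> u = 1 \<and> (\<forall>x. x \<notin> cube c r \<longrightarrow> u x = 0)
      \<and> L2_norm \<Omega> (\<lambda>x. f x - complex_of_real lam *s u x) \<le> C * ((sqrt lam + 1 / r) / r)"
proof -
  obtain B m M where B: "derivative_chain B" and m: "0 < m" and M: "1 \<le> M"
    and supp: "\<And>t. t \<notin> {-1..1} \<Longrightarrow> B 0 t = 0"
    and up: "\<And>n t. n \<le> 3 \<Longrightarrow> cmod (B n t) \<le> M"
    and low: "\<And>t. \<bar>t\<bar> \<le> 1/2 \<Longrightarrow> m \<le> Re (B 0 t)" and im: "\<And>t. Im (B 1 t) = 0"
    by (rule bump_profile) blast
  define C where "C = 21 * sqrt 8 * M ^ 3 / m ^ 3"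
  show ?thesis
  proof (rule that[of C])
    fix \<Omega> :: "(real^3) set" and lam r :: real and c :: "real^3"
    assume \<Omega>: "open \<Omega>" and lam: "0 \<le> lam" and r: "0 < r" and sub: "cube c r \<subseteq> \<Omega>"
    define s where "s = 1 / r"
    define w where "w = sqrt lam + s"
    have s: "0 < s" and sw: "s \<le> w" and w: "0 < w" using r lam by (auto simp: s_def w_def add_nonneg_pos)
    define P where "P i n t = complex_of_real (s ^ n) * B n (s * t + - (s * c $ i))" for i :: 3 and n t
    have arg: "s * t + - (s * d) = (t - d) / r" for t d by (simp add: s_def field_simps diff_divide_distrib)
    have P: "derivative_chain (P i)" for i
      unfolding P_def[abs_def] by (rule derivative_chain_affine[OF B])
    have P0: "P i 0 t = 0" if "t \<notin> {c $ i - r..c $ i + r}" for i t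
    proof -
      have "(t - c $ i) / r \<notin> {-1..1}" using that r by (auto simp: field_simps)
      then have "B 0 ((t - c $ i) / r) = 0" by (rule supp)
      then show ?thesis unfolding P_def arg by simp
    qed
    have Pup: "cmod (P i n t) \<le> s ^ n * M" if "n \<le> 3" for i n t
      unfolding P_def norm_mult using up[OF that] s by (simp add: norm_power mult_left_mono)
    have Plow: "m \<le> Re (P i 0 t)" if "\<bar>t - c $ i\<bar> \<le> r / 2" for i t
    proof -
      have "\<bar>(t - c $ i) / r\<bar> \<le> 1/2" using that r by (simp add: abs_divide field_simps)
      then show ?thesis unfolding P_def arg using low by simp
    qed
    have Pim: "Im (P i 1 t) = 0" for i t by (simp add: P_def im[simplified])
    \<comment> \<open>the scalar factor is kept free until the norm of the field for the factor 1 is known\<close>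
    define F where "F \<kappa> n t = \<kappa> * modulate w (P 1) n t" for \<kappa> n t
    define S where "S \<kappa> = swirl (F \<kappa>) (P 2) (P 3)" for \<kappa>
    define f where "f \<kappa> x = - (S \<kappa> 2 0 0 x + S \<kappa> 0 2 0 x + S \<kappa> 0 0 2 x)" for \<kappa> x
    define e where "e \<kappa> x = f \<kappa> x - complex_of_real lam *s S \<kappa> 0 0 0 x" for \<kappa> x
    have F: "derivative_chain (F \<kappa>)" for \<kappa>
      unfolding F_def[abs_def] by (rule derivative_chain_scale[OF derivative_chain_modulate[OF P]])
    have F0: "F \<kappa> 0 t = 0" if "t \<notin> {c $ 1 - r..c $ 1 + r}" for \<kappa> t
      using P0[OF that] by (simp add: F_def modulate_simps)
    have scale: "S \<kappa> i j k x = \<kappa> *s S 1 i j k x" for \<kappa> i j k x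
      by (simp add: S_def vec_eq_iff forall_3 swirl_component tensor_def F_def)
    have fields: "(S \<kappa> 0 0 0, f \<kappa>) \<in> maxwell_operator \<Omega>" "S \<kappa> i j k \<in> test_functions \<Omega>"
      "x \<notin> cube c r \<Longrightarrow> S \<kappa> i j k x = 0" for \<kappa> i j k x
    proof -
      have box: "cbox (c - (\<chi> i. r)) (c + (\<chi> i. r)) \<subseteq> \<Omega>" using sub by (simp add: cube_def)
      note hyps = F P P box
      have sup: "F \<kappa> 0 t = 0" if "t \<notin> {(c - (\<chi> i. r)) $ 1..(c + (\<chi> i. r)) $ 1}" for t
        using F0 that by simp
      have sup': "P i 0 t = 0" if "t \<notin> {(c - (\<chi> i. r)) $ i..(c + (\<chi> i. r)) $ i}" for i t
        using P0 that by simp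
      show "(S \<kappa> 0 0 0, f \<kappa>) \<in> maxwell_operator \<Omega>"
        unfolding S_def f_def[abs_def] by (rule maxwell_operator_swirl[OF hyps sup sup' sup' \<Omega>])
      show "S \<kappa> i j k \<in> test_functions \<Omega>"
        unfolding S_def by (rule swirl_test[OF hyps sup sup' sup'])
      show "x \<notin> cube c r \<Longrightarrow> S \<kappa> i j k x = 0"
        unfolding S_def cube_def by (rule swirl_zero[OF hyps sup sup' sup'])
    qed
    have e_scale: "e \<kappa> x = \<kappa> *s e 1 x" for \<kappa> x
      unfolding e_def f_def scale[of \<kappa>] by (simp add: vec_eq_iff algebra_simps)
    have SL: "S \<kappa> i j k \<in> Lp 2 \<Omega>" for \<kappa> i j k
      by (rule test_functions_Lp[OF \<Omega> fields(2)]) simp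
    have "(\<lambda>x. (-1) *s (S 1 2 0 0 x + S 1 0 2 0 x + S 1 0 0 2 x) - complex_of_real lam *s S 1 0 0 0 x) \<in> Lp 2 \<Omega>"
      by (intro Lp_2_diff Lp_2_scale Lp_2_add SL)
    then have eL: "e 1 \<in> Lp 2 \<Omega>"
      unfolding e_def[abs_def] f_def vector_scale_uminus .
    define X where "X = 21 * (w\<^sup>2 * s * M ^ 3)"
    have S1: "S 1 = swirl (modulate w (P 1)) (P 2) (P 3)"
      unfolding S_def by (rule arg_cong[where f="\<lambda>F. swirl F _ _"]) (simp add: F_def fun_eq_iff)
    have "\<bar>w\<^sup>2 - lam\<bar> \<le> 2 * w * s"
      using s lam by (simp add: w_def power2_eq_square algebra_simps)
    then have e_bound: "norm (e 1 x) \<le> X" for x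
      unfolding e_def f_def X_def S1 using s sw M Pup
      by (intro swirl_residual_bound) auto
    have e_off: "e 1 x = 0" if "x \<notin> cube c r" for x
      using fields(3)[OF that] by (simp add: e_def f_def)
    have e_norm: "L2_norm \<Omega> (e 1) \<le> X * sqrt ((2 * r) ^ 3)"
      using s w M r by (intro L2_norm_le_on_cube[OF \<Omega> sub eL _ _ e_bound e_off]) (auto simp: X_def)
    define N where "N = L2_norm \<Omega> (S 1 0 0 0)"
    \<comment> \<open>only the second component, which contains the derivative of the wave, is used\<close>
    have N_low: "w * m ^ 3 * sqrt (r ^ 3) \<le> N"
    proof -
      have "w * m ^ 3 * sqrt ((2 * (r / 2)) ^ 3) \<le> L2_norm \<Omega> (S 1 0 0 0)"
      proof (rule L2_norm_ge_on_cube[OF \<Omega> _ SL])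
        show "cube c (r / 2) \<subseteq> \<Omega>" using cube_mono[of "r / 2" r c] sub r by auto
        fix x assume x: "x \<in> cube c (r / 2)"
        have low': "m \<le> cmod (P i 0 (x $ i))" for i
          using Plow[of "x $ i" i] x abs_Re_le_cmod[of "P i 0 (x $ i)"] by (simp add: mem_cube)
        have "w * m \<le> w * Re (P 1 0 (x $ 1))"
          using Plow[of "x $ 1" 1] x w by (simp add: mem_cube)
        also have "\<dots> = Im (\<i> * w * P 1 0 (x $ 1) + P 1 1 (x $ 1))"
          using Pim[of 1 "x $ 1"] by simp
        also have "\<dots> \<le> cmod (\<i> * w * P 1 0 (x $ 1) + P 1 1 (x $ 1))"
          using abs_Im_le_cmod abs_ge_self order_trans by blast
        also have "\<dots> = cmod (modulate w (P 1) (Suc 0) (x $ 1))"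
          by (simp add: modulate_simps norm_mult)
        finally have F1: "w * m \<le> cmod (modulate w (P 1) (Suc 0) (x $ 1))" .
        have "w * m ^ 3 = w * m * m * m" by (simp add: power3_eq_cube)
        also have "\<dots> \<le> cmod (modulate w (P 1) (Suc 0) (x $ 1)) * cmod (P 2 0 (x $ 2)) * cmod (P 3 0 (x $ 3))"
          using F1 low' m w by (intro mult_mono) auto
        also have "\<dots> = cmod (S 1 0 0 0 x $ 2)"
          by (simp add: S1 swirl_component tensor_def norm_mult)
        also have "\<dots> \<le> norm (S 1 0 0 0 x)" by (rule Finite_Cartesian_Product.norm_nth_le)
        finally show "w * m ^ 3 \<le> norm (S 1 0 0 0 x)" .
      qed (use w m r in auto)
      then show ?thesis by (simp add: N_def)
    qed
    have N: "0 < N" using N_low w m r by (smt (verit) mult_pos_pos real_sqrt_gt_zero zero_less_power)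
    define \<kappa> where "\<kappa> = complex_of_real (1 / N)"
    have \<kappa>: "cmod \<kappa> = 1 / N" using N unfolding \<kappa>_def norm_of_real by simp
    have "L2_norm \<Omega> (S \<kappa> 0 0 0) = cmod \<kappa> * N"
      unfolding N_def L2_norm_scale[symmetric] scale[of \<kappa>, symmetric] ..
    then have "L2_norm \<Omega> (S \<kappa> 0 0 0) = 1" using N \<kappa> by simp
    moreover have "L2_norm \<Omega> (e \<kappa>) \<le> C * ((sqrt lam + 1 / r) / r)"
    proof -
      have "L2_norm \<Omega> (e \<kappa>) = L2_norm \<Omega> (e 1) / N"
        using L2_norm_scale[of \<Omega> \<kappa> "e 1"] unfolding e_scale[of \<kappa>, symmetric] \<kappa> by simp
      also have "\<dots> \<le> X * sqrt ((2 * r) ^ 3) / (w * m ^ 3 * sqrt (r ^ 3))"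
        using e_norm N_low w m r s M by (intro frac_le) (auto simp: X_def)
      also have "sqrt ((2 * r) ^ 3) = sqrt 8 * sqrt (r ^ 3)"
        by (simp add: power_mult_distrib flip: real_sqrt_mult)
      also have "X * (sqrt 8 * sqrt (r ^ 3)) / (w * m ^ 3 * sqrt (r ^ 3)) = C * (w * s)"
        using w m r by (simp add: X_def C_def power2_eq_square)
      also have "w * s = (sqrt lam + 1 / r) / r" by (simp add: w_def s_def)
      finally show ?thesis .
    qed
    ultimately show "\<exists>u f. (u, f) \<in> maxwell_operator \<Omega> \<and> L2_norm \<Omega> u = 1
      \<and> (\<forall>x. x \<notin> cube c r \<longrightarrow> u x = 0)
      \<and> L2_norm \<Omega> (\<lambda>x. f x - complex_of_real lam *s u x) \<le> C * ((sqrt lam + 1 / r) / r)"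
      by (intro exI[of _ "S \<kappa> 0 0 0"] exI[of _ "f \<kappa>"]) (simp add: fields(1,3) e_def[abs_def])
  qed
qed

section \<open>The essential spectrum\<close>

text \<open>
  A cube of edge \<open>d\<close> in any orientation contains the ball of radius \<open>d/2\<close> around its centre, and that ball
  contains an axis-parallel cube of half edge \<open>d/8\<close>, since the sum of the three coordinate distances is at most \<open>3d/8\<close>.
\<close>
lemma open_cube_contains_cube:
  assumes "open_cube d Q"
  shows "\<exists>c. cube c (d / 8) \<subseteq> Q"
proof -
  obtain a :: "real^3" and R :: "real^3 \<Rightarrow> real^3" where d: "0 < d" and R: "orthogonal_transformation R"
    and Q: "Q = (\<lambda>x. a + R x) ` box 0 (\<chi> i. d)"
    using assms unfolding open_cube_def by blast
  define h where "h = (\<chi> i. d / 2 :: real^3)"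
  have "cube (a + R h) (d / 8) \<subseteq> Q"
  proof
    fix y assume y: "y \<in> cube (a + R h) (d / 8)"
    obtain x where x: "R x = y - a" using orthogonal_transformation_surj[OF R] by (metis surjD)
    have "norm (x - h) = norm (R (x - h))" using orthogonal_transformation_norm[OF R] by simp
    also have "R (x - h) = y - (a + R h)"
      using x linear_diff[OF orthogonal_transformation_linear[OF R]] by simp
    also have "norm \<dots> \<le> (\<Sum>i\<in>UNIV. \<bar>(y - (a + R h)) $ i\<bar>)" by (rule norm_le_l1_cart)
    also have "\<dots> \<le> (\<Sum>i\<in>(UNIV :: 3 set). d / 8)"
      using y by (intro sum_mono) (simp add: mem_cube)
    also have "\<dots> < d / 2" using d by simp
    finally have "norm (x - h) < d / 2" .
    then have "\<bar>x $ i - d / 2\<bar> < d / 2" for i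
      using Finite_Cartesian_Product.norm_nth_le[of "x - h" i] by (simp add: h_def)
    then have "0 < x $ i \<and> x $ i < d" for i by (smt (verit) field_sum_of_halves)
    then have "x \<in> box 0 (\<chi> i. d)" by (simp add: mem_box_cart)
    moreover have "y = a + R x" using x by simp
    ultimately show "y \<in> Q" unfolding Q by blast
  qed
  then show ?thesis ..
qed

text \<open>
  The normalised wave packets in disjoint cubes of growing size form a singular sequence.
\<close>
lemma maxwell_nonneg_in_essential_spectrum:
  assumes \<Omega>: "open \<Omega>" and qc: "quasi_conical \<Omega>" and lam: "0 \<le> lam"
  shows "complex_of_real lam \<in> essential_spectrum \<Omega> (H_div0 \<Omega>) (maxwell_operator \<Omega>)"
proof -
  obtain Q d where Q: "\<And>n. open_cube (d n) (Q n)" "\<And>n. Q n \<subseteq> \<Omega>" "disjoint_family Q"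
    and d: "filterlim d at_top sequentially"
    using qc by (auto simp: quasi_conical_def)
  have "\<forall>n. \<exists>c. cube c (d n / 8) \<subseteq> Q n"
    using open_cube_contains_cube[OF Q(1)] by blast
  from choice[OF this] obtain c where c: "\<And>n. cube (c n) (d n / 8) \<subseteq> Q n" by blast
  define r where "r n = d n / 8" for n
  have r: "0 < r n" for n using Q(1)[of n] by (simp add: r_def open_cube_def)
  have sub: "cube (c n) (r n) \<subseteq> \<Omega>" for n using c[of n] Q(2)[of n] by (auto simp: r_def)
  have disj: "disjoint_family (\<lambda>n. cube (c n) (r n))"
    using Q(3) c unfolding disjoint_family_on_def r_def by blast
  obtain C where "\<And>\<Omega> lam c r. open \<Omega> \<Longrightarrow> 0 \<le> lam \<Longrightarrow> 0 < r \<Longrightarrow> cube c r \<subseteq> \<Omega> \<Longrightarrow>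
    \<exists>u f. (u, f) \<in> maxwell_operator \<Omega> \<and> L2_norm \<Omega> u = 1 \<and> (\<forall>x. x \<notin> cube c r \<longrightarrow> u x = 0)
      \<and> L2_norm \<Omega> (\<lambda>x. f x - complex_of_real lam *s u x) \<le> C * ((sqrt lam + 1 / r) / r)"
    using maxwell_quasimode by blast
  from this[OF \<Omega> lam r sub] have "\<forall>n. \<exists>u f. (u, f) \<in> maxwell_operator \<Omega> \<and> L2_norm \<Omega> u = 1
      \<and> (\<forall>x. x \<notin> cube (c n) (r n) \<longrightarrow> u x = 0)
      \<and> L2_norm \<Omega> (\<lambda>x. f x - complex_of_real lam *s u x) \<le> C * ((sqrt lam + 1 / r n) / r n)"
    by blast
  from choice[OF this] obtain u where "\<forall>n. \<exists>f. (u n, f) \<in> maxwell_operator \<Omega> \<and> L2_norm \<Omega> (u n) = 1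
      \<and> (\<forall>x. x \<notin> cube (c n) (r n) \<longrightarrow> u n x = 0)
      \<and> L2_norm \<Omega> (\<lambda>x. f x - complex_of_real lam *s u n x) \<le> C * ((sqrt lam + 1 / r n) / r n)" ..
  from choice[OF this] obtain f where uf: "\<And>n. (u n, f n) \<in> maxwell_operator \<Omega>"
    "\<And>n. L2_norm \<Omega> (u n) = 1" "\<And>n x. x \<notin> cube (c n) (r n) \<Longrightarrow> u n x = 0"
    "\<And>n. L2_norm \<Omega> (\<lambda>x. f n x - complex_of_real lam *s u n x) \<le> C * ((sqrt lam + 1 / r n) / r n)"
    by blast
  have uL: "u n \<in> Lp 2 \<Omega>" for n
    using uf(1)[of n] by (simp add: maxwell_operator_def form_operator_def X_N0_def H_div0_def)
  have "filterlim r at_top sequentially"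
    unfolding r_def[abs_def] using d filterlim_tendsto_pos_mult_at_top[OF tendsto_const[of "1/8"], of d sequentially]
    by simp
  then have inv: "(\<lambda>n. 1 / r n) \<longlonglongrightarrow> 0"
    using tendsto_inverse_0_at_top by (simp add: inverse_eq_divide)
  have "(\<lambda>n. C * ((sqrt lam + 1 / r n) * (1 / r n))) \<longlonglongrightarrow> C * ((sqrt lam + 0) * 0)"
    by (intro tendsto_mult tendsto_add tendsto_const inv)
  then have "(\<lambda>n. C * ((sqrt lam + 1 / r n) / r n)) \<longlonglongrightarrow> 0" by simp
  then have "(\<lambda>n. L2_norm \<Omega> (\<lambda>x. f n x - complex_of_real lam *s u n x)) \<longlonglongrightarrow> 0"
    by (rule Lim_null_comparison[rotated])
      (use uf(4) in \<open>simp add: L2_norm_def\<close>)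
  moreover have "(\<lambda>n. L2_inner \<Omega> (u n) v) \<longlonglongrightarrow> 0" if "v \<in> H_div0 \<Omega>" for v
  proof (rule disjoint_supports_weakly_null[OF \<Omega> uL uf(2) disj _ uf(3)])
    show "cube (c n) (r n) \<in> sets lebesgue" for n by (simp add: cube_def)
    show "v \<in> Lp 2 \<Omega>" using that by (simp add: H_div0_def)
  qed
  ultimately show ?thesis using uf(1,2) unfolding essential_spectrum_def mem_Collect_eq
    by (intro exI[of _ u] exI[of _ f]) simp
qed

theorem lemma4p1:
  fixes \<Omega> :: "(real^3) set"
  assumes "open \<Omega>" and "quasi_conical \<Omega>"
  shows "essential_spectrum \<Omega> (H_div0 \<Omega>) (maxwell_operator \<Omega>) = complex_of_real ` {0..}"
  using essential_spectrum_maxwell_nonneg[OF assms(1)] maxwell_nonneg_in_essential_spectrum[OF assms]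
  by auto

end
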